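(* Let $f \in \mathcal{C}_{2\pi}$, let $A_n[f]$ be the Toeplitz matrix generated by $f$ and $c_n[f]$ the optimal circulant preconditioner for $A_n[f]$. For every $\epsilon>0$ there exist positive integers $N$ and $M$ such that for every $n>N$ there are matrices $\mathcal R_n[f],\mathcal E_n[f]\in\mathbb{C}^{n\times n}$ with \[ \sin c_n[f]-\sin A_n[f] = \mathcal R_n[f]+\mathcal E_n[f],\qquad \operatorname{rank}\mathcal R_n[f]\le 2M,\qquad \|\mathcal E_n[f]\|_2\le\epsilon. \]
   Context: $\mathcal{C}_{2\pi}$ denotes the Banach space of all $2\pi$-periodic continuous complex-valued functions on $\mathbb{R}$ with the supremum norm $\|\cdot\|_\infty$. For $f\in\mathcal{C}_{2\pi}$ its Fourier coefficients are $a_k=\frac{1}{2\pi}\int_{-\pi}^{\pi} f(\theta)e^{-\mathbf{i}k\theta}\,d\theta$, $k\in\mathbb{Z}$. The Toeplitz matrix generated by $f$ is the $n\times n$ matrix $A_n[f]$ whose $(j,k)$ entry is $a_{j-k}$. The optimal circulant preconditioner $c_n[f]$ is the $n\times n$ circulant matrix whose $(j,k)$ entry is $c_{(j-k)\bmod n}$, where $c_k=\frac{(n-k)a_k+k\,a_{k-n}}{n}$ for $0\le k<n$. For a square matrix $X$, $\sin X=\sum_{m\ge0}\frac{(-1)^m}{(2m+1)!}X^{2m+1}$. $\|\cdot\|_2$ is the spectral norm. *)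

theory Defs
  imports "HOL-Analysis.Analysis" "Jordan_Normal_Form.DL_Rank"
begin

definition fourier_coeff :: "(real \<Rightarrow> complex) \<Rightarrow> int \<Rightarrow> complex" where
  "fourier_coeff f k =
     integral {-pi..pi} (\<lambda>\<theta>. f \<theta> * exp (- (\<i> * of_int k * of_real \<theta>))) / of_real (2 * pi)"

definition toeplitz_mat :: "(real \<Rightarrow> complex) \<Rightarrow> nat \<Rightarrow> complex mat" where
  "toeplitz_mat f n = mat n n (\<lambda>(j,k). fourier_coeff f (int j - int k))"

definition opt_circ_coeff :: "(real \<Rightarrow> complex) \<Rightarrow> nat \<Rightarrow> nat \<Rightarrow> complex" where
  "opt_circ_coeff f n k =
     (of_nat (n - k) * fourier_coeff f (int k) + of_nat k * fourier_coeff f (int k - int n)) / of_nat n"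

definition opt_circulant :: "(real \<Rightarrow> complex) \<Rightarrow> nat \<Rightarrow> complex mat" where
  "opt_circulant f n = mat n n (\<lambda>(j,k). opt_circ_coeff f n (nat ((int j - int k) mod int n)))"

definition mat_sin :: "complex mat \<Rightarrow> complex mat" where
  "mat_sin X = mat (dim_row X) (dim_col X)
     (\<lambda>(i,j). \<Sum>m. ((-1) ^ m / fact (2*m+1)) * (X ^\<^sub>m (2*m+1)) $$ (i,j))"

definition vec_norm2 :: "complex vec \<Rightarrow> real" where
  "vec_norm2 v = sqrt (\<Sum>i<dim_vec v. (cmod (v $ i))\<^sup>2)"

definition spec_norm :: "complex mat \<Rightarrow> real" where
  "spec_norm A = Sup {vec_norm2 (A *\<^sub>v x) | x. x \<in> carrier_vec (dim_col A) \<and> vec_norm2 x \<le> 1}"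

end

theory Submission
  imports Defs
begin

text \<open>Call a sequence of matrices null if, for every \<open>\<epsilon>\<close>, it is eventually a matrix of bounded rank
  plus one of norm at most \<open>\<epsilon>\<close>. Null sequences are closed under sums, under multiplication by
  bounded sequences, and under uniform limits. Both \<open>f \<mapsto> A\<^sub>n[f]\<close> and \<open>f \<mapsto> c\<^sub>n[f]\<close> are linear and bounded
  by the supremum norm, so \<open>c\<^sub>n[f] - A\<^sub>n[f]\<close> is null for every \<open>f\<close> as soon as it is null for the
  Fourier modes, where it is a corner plus a multiple \<open>O(1/n)\<close> of one diagonal. Telescoping
  \<open>X\<^sup>k - Y\<^sup>k\<close> and truncating the sine series carries this over to the sines.\<close>

text \<open>A low-rank part is unavoidable: for a mode \<open>c * fourier_mode k\<close> with
  \<open>k\<close> nonzero and \<open>n\<close> large, the corner entries of the circulant have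
  modulus \<open>(1 - |k|/n) * |c|\<close> where the Toeplitz matrix vanishes, so the difference
  does not tend to zero in norm. The delicate estimate is the norm bound by the supremum of
  \<open>f\<close>. Fourier coefficients of a continuous function need not be absolutely summable,
  so no bound on row sums can give it; the Toeplitz form is written as an integral instead, and the
  circulant inherits the bound by averaging. As \<open>f\<close> is complex-valued, the matrices
  need not be Hermitian, hence forms in two independent vectors. Rank bound and threshold must be
  chosen before \<open>n\<close>. For the sine this works because the cut-off of the series depends
  only on a common norm bound of the matrices.\<close>

unbundle no vec_syntax

section \<open>Operator norm bounds\<close>

text \<open>An inequality instead of a supremum: sums, products and limits then need no boundedness
  or nonemptiness argument. The supremum reappears only in \<open>spec_norm_le\<close>.\<close>

definition opnorm_le :: "complex mat \<Rightarrow> real \<Rightarrow> bool" where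
  "opnorm_le A B \<longleftrightarrow> (\<forall>x \<in> carrier_vec (dim_col A). vec_norm2 (A *\<^sub>v x) \<le> B * vec_norm2 x)"

lemma vec_norm2_L2_set: "vec_norm2 v = L2_set (\<lambda>i. cmod (v $ i)) {..<dim_vec v}"
  by (simp add: vec_norm2_def L2_set_def)

lemma vec_norm2_nonneg [simp]: "0 \<le> vec_norm2 v"
  by (simp add: vec_norm2_L2_set)

lemma vec_norm2_triangle:
  assumes "v \<in> carrier_vec n" "w \<in> carrier_vec n"
  shows "vec_norm2 (v + w) \<le> vec_norm2 v + vec_norm2 w"
proof -
  have "L2_set (\<lambda>i. cmod ((v + w) $ i)) {..<n}
      \<le> L2_set (\<lambda>i. cmod (v $ i) + cmod (w $ i)) {..<n}"
    using assms by (intro L2_set_mono) (auto intro: norm_triangle_ineq)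
  also have "\<dots> \<le> L2_set (\<lambda>i. cmod (v $ i)) {..<n} + L2_set (\<lambda>i. cmod (w $ i)) {..<n}"
    by (rule L2_set_triangle_ineq)
  finally show ?thesis using assms by (simp add: vec_norm2_L2_set)
qed

lemma vec_norm2_smult: "vec_norm2 (c \<cdot>\<^sub>v v) = cmod c * vec_norm2 v"
proof -
  have "L2_set (\<lambda>i. cmod ((c \<cdot>\<^sub>v v) $ i)) {..<dim_vec v} = L2_set (\<lambda>i. cmod c * cmod (v $ i)) {..<dim_vec v}"
    by (intro L2_set_cong) (auto simp: norm_mult)
  then show ?thesis by (simp add: vec_norm2_L2_set L2_set_right_distrib)
qed

lemma cmod_index_le_vec_norm2: "i < dim_vec v \<Longrightarrow> cmod (v $ i) \<le> vec_norm2 v"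
  unfolding vec_norm2_L2_set by (rule member_le_L2_set) auto

lemma opnorm_leD:
  "opnorm_le A B \<Longrightarrow> x \<in> carrier_vec (dim_col A) \<Longrightarrow> vec_norm2 (A *\<^sub>v x) \<le> B * vec_norm2 x"
  by (simp add: opnorm_le_def)

lemma opnorm_le_mono: "opnorm_le A B \<Longrightarrow> B \<le> C \<Longrightarrow> opnorm_le A C"
  unfolding opnorm_le_def by (meson mult_right_mono order_trans vec_norm2_nonneg)

lemma opnorm_le_one: "opnorm_le (1\<^sub>m n) 1"
  by (simp add: opnorm_le_def)

lemma opnorm_le_add:
  assumes "A \<in> carrier_mat n n" "B \<in> carrier_mat n n" "opnorm_le A a" "opnorm_le B b"
  shows "opnorm_le (A + B) (a + b)"
  unfolding opnorm_le_def
proof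
  fix x :: "complex Matrix.vec" assume "x \<in> carrier_vec (dim_col (A + B))"
  then have x: "x \<in> carrier_vec n" using assms by auto
  have "vec_norm2 ((A + B) *\<^sub>v x) \<le> vec_norm2 (A *\<^sub>v x) + vec_norm2 (B *\<^sub>v x)"
    using assms x by (subst add_mult_distrib_mat_vec) (auto intro!: vec_norm2_triangle[of _ n])
  also have "\<dots> \<le> a * vec_norm2 x + b * vec_norm2 x"
    using assms x by (intro add_mono opnorm_leD) auto
  finally show "vec_norm2 ((A + B) *\<^sub>v x) \<le> (a + b) * vec_norm2 x"
    by (simp add: algebra_simps)
qed

lemma opnorm_le_smult:
  assumes "opnorm_le A a" shows "opnorm_le (c \<cdot>\<^sub>m A) (cmod c * a)"
  unfolding opnorm_le_def
proof
  fix x :: "complex Matrix.vec" assume "x \<in> carrier_vec (dim_col (c \<cdot>\<^sub>m A))"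
  then have x: "x \<in> carrier_vec (dim_col A)" by simp
  have "(c \<cdot>\<^sub>m A) *\<^sub>v x = c \<cdot>\<^sub>v (A *\<^sub>v x)"
    using x by (intro eq_vecI) auto
  then show "vec_norm2 ((c \<cdot>\<^sub>m A) *\<^sub>v x) \<le> cmod c * a * vec_norm2 x"
    using opnorm_leD[OF assms x] by (simp add: vec_norm2_smult mult_left_mono mult.assoc)
qed

lemma opnorm_le_diff:
  assumes "A \<in> carrier_mat n n" "B \<in> carrier_mat n n" "opnorm_le A a" "opnorm_le B b"
  shows "opnorm_le (A - B) (a + b)"
proof -
  have "A - B = A + (-1) \<cdot>\<^sub>m B" using assms by (intro eq_matI) auto
  then show ?thesis
    using opnorm_le_add[of A n "(-1) \<cdot>\<^sub>m B" a b] opnorm_le_smult[OF assms(4), of "-1"] assms by simp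
qed

lemma opnorm_le_mult:
  assumes "A \<in> carrier_mat n n" "B \<in> carrier_mat n n" "opnorm_le A a" "opnorm_le B b" "0 \<le> a"
  shows "opnorm_le (A * B) (a * b)"
  unfolding opnorm_le_def
proof
  fix x :: "complex Matrix.vec" assume "x \<in> carrier_vec (dim_col (A * B))"
  then have x: "x \<in> carrier_vec n" using assms by auto
  have "vec_norm2 ((A * B) *\<^sub>v x) = vec_norm2 (A *\<^sub>v (B *\<^sub>v x))"
    using assms x by (subst assoc_mult_mat_vec) auto
  also have "\<dots> \<le> a * vec_norm2 (B *\<^sub>v x)"
    using assms x by (intro opnorm_leD) auto
  also have "\<dots> \<le> a * (b * vec_norm2 x)"
    using assms x by (intro mult_left_mono opnorm_leD) auto
  finally show "vec_norm2 ((A * B) *\<^sub>v x) \<le> a * b * vec_norm2 x"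
    by (simp add: algebra_simps)
qed

lemma opnorm_le_pow:
  assumes "A \<in> carrier_mat n n" "opnorm_le A a" "0 \<le> a"
  shows "opnorm_le (A ^\<^sub>m k) (a ^ k)"
proof (induction k)
  case 0
  then show ?case using assms by (simp add: opnorm_le_one)
next
  case (Suc k)
  then show ?case
    using opnorm_le_mult[OF pow_carrier_mat[OF assms(1)] assms(1) Suc assms(2)] assms
    by (simp add: mult.commute)
qed

lemma cmod_entry_le_opnorm:
  assumes "A \<in> carrier_mat n n" "opnorm_le A a" "i < n" "j < n"
  shows "cmod (A $$ (i,j)) \<le> a"
proof -
  have "vec_norm2 (unit_vec n j) = sqrt (\<Sum>i<n. if i = j then 1 else 0)"
    unfolding vec_norm2_def using assms
    by (intro arg_cong[where f = sqrt] sum.cong) auto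
  then have 1: "vec_norm2 (unit_vec n j) = 1"
    using assms by simp
  have "cmod (A $$ (i,j)) = cmod ((A *\<^sub>v unit_vec n j) $ i)"
    using assms by simp
  also have "\<dots> \<le> vec_norm2 (A *\<^sub>v unit_vec n j)"
    using assms by (intro cmod_index_le_vec_norm2) auto
  also have "\<dots> \<le> a" using opnorm_leD[OF assms(2), of "unit_vec n j"] assms 1 by auto
  finally show ?thesis .
qed

text \<open>For fixed \<open>x\<close> the norm of \<open>S d *\<^sub>v x\<close> depends
  continuously on finitely many entries, so a bound uniform in \<open>d\<close> survives entrywise
  convergence.\<close>

lemma opnorm_le_limit:
  assumes A: "A \<in> carrier_mat n n" and S: "\<And>d::nat. S d \<in> carrier_mat n n" "\<And>d. opnorm_le (S d) a"
    and lim: "\<And>i j. i < n \<Longrightarrow> j < n \<Longrightarrow> (\<lambda>d. S d $$ (i,j)) \<longlonglongrightarrow> A $$ (i,j)"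
  shows "opnorm_le A a"
  unfolding opnorm_le_def
proof
  fix x :: "complex Matrix.vec" assume "x \<in> carrier_vec (dim_col A)"
  then have x: "x \<in> carrier_vec n" using A by auto
  have eq: "vec_norm2 (M *\<^sub>v x) = sqrt (\<Sum>i<n. (cmod (\<Sum>j<n. M $$ (i,j) * x $ j))\<^sup>2)"
    if "M \<in> carrier_mat n n" for M
    using that x unfolding vec_norm2_def
    by (auto intro!: sum.cong simp: scalar_prod_def atLeast0LessThan)
  have "(\<lambda>d. vec_norm2 (S d *\<^sub>v x)) \<longlonglongrightarrow> vec_norm2 (A *\<^sub>v x)"
    unfolding eq[OF A] eq[OF S(1)] by (intro tendsto_intros lim) auto
  moreover have "vec_norm2 (S d *\<^sub>v x) \<le> a * vec_norm2 x" for d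
    using opnorm_leD[OF S(2)[of d], of x] S(1)[of d] x by auto
  ultimately show "vec_norm2 (A *\<^sub>v x) \<le> a * vec_norm2 x"
    by (intro LIMSEQ_le_const2) auto
qed

text \<open>By homogeneity the bound below is equivalent to \<open>\<bar>y\<^sup>T A x\<bar> \<le> B \<parallel>x\<parallel> \<parallel>y\<parallel>\<close>; the quadratic right-hand
  side is what integrates termwise for Toeplitz matrices. Taking \<open>y\<close> to be the conjugate of \<open>A x / B\<close>
  gives the operator norm bound.\<close>

definition form_le :: "nat \<Rightarrow> (nat \<Rightarrow> nat \<Rightarrow> complex) \<Rightarrow> real \<Rightarrow> bool" where
  "form_le n a B \<longleftrightarrow> (\<forall>x y :: nat \<Rightarrow> complex.
     cmod (\<Sum>j<n. \<Sum>k<n. y j * a j k * x k) \<le> B / 2 * ((\<Sum>k<n. (cmod (x k))\<^sup>2) + (\<Sum>j<n. (cmod (y j))\<^sup>2)))"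

lemma opnorm_le_if_form_le:
  assumes A: "A \<in> carrier_mat n n" and form: "form_le n (\<lambda>j k. A $$ (j,k)) B" and B: "0 < B"
  shows "opnorm_le A B"
  unfolding opnorm_le_def
proof
  fix x :: "complex Matrix.vec" assume "x \<in> carrier_vec (dim_col A)"
  then have x: "x \<in> carrier_vec n" using A by auto
  define w where "w j = (\<Sum>k<n. A $$ (j,k) * x $ k)" for j
  have Ax: "vec_norm2 (A *\<^sub>v x) = sqrt (\<Sum>j<n. (cmod (w j))\<^sup>2)"
    using A x unfolding vec_norm2_def w_def
    by (auto intro!: sum.cong simp: scalar_prod_def atLeast0LessThan)
  define y where "y j = cnj (w j) / of_real B" for j
  define p q where "p = (\<Sum>j<n. (cmod (w j))\<^sup>2)" and "q = (\<Sum>k<n. (cmod (x $ k))\<^sup>2)"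
  have "(\<Sum>j<n. \<Sum>k<n. y j * A $$ (j,k) * x $ k) = (\<Sum>j<n. y j * w j)"
    by (simp add: w_def sum_distrib_left mult.assoc)
  also have "\<dots> = of_real (p / B)"
    by (simp add: p_def y_def sum_divide_distrib complex_norm_square mult.commute del: of_real_power)
  finally have "cmod (of_real (p / B)) \<le> B / 2 * (q + (\<Sum>j<n. (cmod (y j))\<^sup>2))"
    using form[unfolded form_le_def, rule_format, of y "\<lambda>k. x $ k"] by (simp add: q_def)
  moreover have "(\<Sum>j<n. (cmod (y j))\<^sup>2) = p / B\<^sup>2"
    using B by (simp add: y_def p_def norm_divide power_divide sum_divide_distrib)
  moreover have "0 \<le> p" by (simp add: p_def sum_nonneg)
  \<comment> \<open>The right side contains half of \<open>p / B\<close>; absorbing it on the left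
    leaves \<open>p \<le> B\<^sup>2 * q\<close>.\<close>
  ultimately have "p / B \<le> B / 2 * (q + p / B\<^sup>2)"
    using B by (simp add: norm_divide)
  then have "p \<le> B\<^sup>2 * q"
    using B by (simp add: field_simps power2_eq_square)
  then have "sqrt p \<le> B * sqrt q"
    using B by (metis abs_of_pos real_sqrt_abs real_sqrt_le_iff real_sqrt_mult)
  moreover have "vec_norm2 x = sqrt q" using x by (simp add: vec_norm2_def q_def)
  ultimately show "vec_norm2 (A *\<^sub>v x) \<le> B * vec_norm2 x" by (simp add: Ax p_def)
qed

text \<open>The Schur test: the inequality of arithmetic and geometric means, weighted by the
  modulus of each entry, splits the form into row sums and column sums.\<close>

lemma form_le_Schur:
  assumes row: "\<And>j. j < n \<Longrightarrow> (\<Sum>k<n. cmod (a j k)) \<le> B"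
    and col: "\<And>k. k < n \<Longrightarrow> (\<Sum>j<n. cmod (a j k)) \<le> B"
  shows "form_le n a B"
  unfolding form_le_def
proof (intro allI)
  fix x y :: "nat \<Rightarrow> complex"
  have amgm: "cmod (y j * a j k * x k) \<le> (cmod (a j k) * (cmod (x k))\<^sup>2 + cmod (a j k) * (cmod (y j))\<^sup>2) / 2" for j k
  proof -
    have "cmod (y j) * cmod (x k) \<le> ((cmod (x k))\<^sup>2 + (cmod (y j))\<^sup>2) / 2"
      using sum_squares_bound[of "cmod (y j)" "cmod (x k)"] by simp
    from mult_left_mono[OF this, of "cmod (a j k)"] show ?thesis
      by (simp add: norm_mult algebra_simps)
  qed
  have "cmod (\<Sum>j<n. \<Sum>k<n. y j * a j k * x k)
      \<le> (\<Sum>j<n. \<Sum>k<n. (cmod (a j k) * (cmod (x k))\<^sup>2 + cmod (a j k) * (cmod (y j))\<^sup>2) / 2)"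
    by (intro order_trans[OF norm_sum] sum_mono amgm)
  also have "\<dots> = ((\<Sum>k<n. (\<Sum>j<n. cmod (a j k)) * (cmod (x k))\<^sup>2)
      + (\<Sum>j<n. (\<Sum>k<n. cmod (a j k)) * (cmod (y j))\<^sup>2)) / 2"
    by (simp add: sum_divide_distrib[symmetric] sum.distrib sum_distrib_right)
       (rule sum.swap)
  also have "\<dots> \<le> ((\<Sum>k<n. B * (cmod (x k))\<^sup>2) + (\<Sum>j<n. B * (cmod (y j))\<^sup>2)) / 2"
    using row col by (intro divide_right_mono add_mono sum_mono mult_right_mono) auto
  finally show "cmod (\<Sum>j<n. \<Sum>k<n. y j * a j k * x k)
      \<le> B / 2 * ((\<Sum>k<n. (cmod (x k))\<^sup>2) + (\<Sum>j<n. (cmod (y j))\<^sup>2))"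
    by (simp only: sum_distrib_left[symmetric] distrib_left[symmetric] times_divide_eq_left)
qed

text \<open>Moving the permutation from the matrix to the test vectors leaves their sums of squares
  unchanged.\<close>

lemma form_le_permute:
  assumes form: "form_le n a B" and bij: "bij_betw \<sigma> {..<n} {..<n}"
  shows "form_le n (\<lambda>j k. a (\<sigma> j) (\<sigma> k)) B"
  unfolding form_le_def
proof (intro allI)
  fix x y :: "nat \<Rightarrow> complex"
  define \<tau> where "\<tau> = inv_into {..<n} \<sigma>"
  have \<tau>: "\<tau> (\<sigma> j) = j" if "j < n" for j
    using bij that by (simp add: \<tau>_def bij_betw_inv_into_left)
  have re: "(\<Sum>j<n. g (\<sigma> j)) = (\<Sum>j<n. g j)" for g :: "nat \<Rightarrow> 'b::comm_monoid_add"
    using sum.reindex_bij_betw[OF bij] .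
  have "(\<Sum>j<n. \<Sum>k<n. y j * a (\<sigma> j) (\<sigma> k) * x k)
      = (\<Sum>j<n. \<Sum>k<n. y (\<tau> (\<sigma> j)) * a (\<sigma> j) (\<sigma> k) * x (\<tau> (\<sigma> k)))"
    by (simp add: \<tau>)
  also have "\<dots> = (\<Sum>j<n. \<Sum>k<n. y (\<tau> j) * a j k * x (\<tau> k))"
    unfolding re[of "\<lambda>k. y (\<tau> (\<sigma> j)) * a (\<sigma> j) k * x (\<tau> k)" for j]
    by (rule re[of "\<lambda>j. \<Sum>k<n. y (\<tau> j) * a j k * x (\<tau> k)"])
  also have "cmod \<dots> \<le> B / 2 * ((\<Sum>k<n. (cmod (x (\<tau> k)))\<^sup>2) + (\<Sum>j<n. (cmod (y (\<tau> j)))\<^sup>2))"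
    using form[unfolded form_le_def, rule_format, of "\<lambda>j. y (\<tau> j)" "\<lambda>k. x (\<tau> k)"] by simp
  also have "\<dots> = B / 2 * ((\<Sum>k<n. (cmod (x k))\<^sup>2) + (\<Sum>j<n. (cmod (y j))\<^sup>2))"
    using re[of "\<lambda>k. (cmod (x (\<tau> k)))\<^sup>2"] re[of "\<lambda>k. (cmod (y (\<tau> k)))\<^sup>2"] by (simp add: \<tau>)
  finally show "cmod (\<Sum>j<n. \<Sum>k<n. y j * a (\<sigma> j) (\<sigma> k) * x k)
      \<le> B / 2 * ((\<Sum>k<n. (cmod (x k))\<^sup>2) + (\<Sum>j<n. (cmod (y j))\<^sup>2))" .
qed

lemma form_le_average:
  assumes form: "\<And>s. s < m \<Longrightarrow> form_le n (a s) B" and m: "0 < m"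
  shows "form_le n (\<lambda>j k. (\<Sum>s<m. a s j k) / of_nat m) B"
  unfolding form_le_def
proof (intro allI)
  fix x y :: "nat \<Rightarrow> complex"
  let ?F = "\<lambda>a. \<Sum>j<n. \<Sum>k<n. y j * a j k * x k"
  let ?C = "B / 2 * ((\<Sum>k<n. (cmod (x k))\<^sup>2) + (\<Sum>j<n. (cmod (y j))\<^sup>2))"
  have "?F (\<lambda>j k. (\<Sum>s<m. a s j k) / of_nat m)
      = (\<Sum>j<n. \<Sum>k<n. \<Sum>s<m. y j * a s j k * x k) / of_nat m"
    by (simp add: sum_divide_distrib sum_distrib_left sum_distrib_right)
  also have "(\<Sum>j<n. \<Sum>k<n. \<Sum>s<m. y j * a s j k * x k) = (\<Sum>j<n. \<Sum>s<m. \<Sum>k<n. y j * a s j k * x k)"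
    by (intro sum.cong[OF refl] sum.swap)
  also have "\<dots> = (\<Sum>s<m. ?F (a s))"
    by (rule sum.swap)
  also have "cmod ((\<Sum>s<m. ?F (a s)) / of_nat m) \<le> (\<Sum>s<m. ?C) / real m"
    unfolding norm_divide norm_of_nat
    using form by (intro divide_right_mono sum_norm_le) (auto simp only: form_le_def lessThan_iff of_nat_0_le_iff)
  also have "\<dots> = ?C" using m by simp
  finally show "cmod (?F (\<lambda>j k. (\<Sum>s<m. a s j k) / of_nat m)) \<le> ?C" .
qed

lemma spec_norm_le:
  assumes "opnorm_le A B" "0 \<le> B"
  shows "spec_norm A \<le> B"
  unfolding spec_norm_def
proof (rule cSup_least)
  \<comment> \<open>The zero vector makes the set nonempty, so its supremum lies below every upper
    bound.\<close>
  have "vec_norm2 (0\<^sub>v (dim_col A)) \<le> 1" by (simp add: vec_norm2_def)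
  then show "{vec_norm2 (A *\<^sub>v x) |x. x \<in> carrier_vec (dim_col A) \<and> vec_norm2 x \<le> 1} \<noteq> {}"
    using zero_carrier_vec[of "dim_col A"] by blast
next
  fix s assume "s \<in> {vec_norm2 (A *\<^sub>v x) |x. x \<in> carrier_vec (dim_col A) \<and> vec_norm2 x \<le> 1}"
  then obtain x where "s = vec_norm2 (A *\<^sub>v x)" "x \<in> carrier_vec (dim_col A)" "vec_norm2 x \<le> 1"
    by blast
  then show "s \<le> B"
    using opnorm_leD[OF assms(1), of x] assms(2) mult_left_mono[of "vec_norm2 x" 1 B] by simp
qed

section \<open>Rank bounds\<close>

text \<open>A list of outer products: sums append lists, and a product with a matrix changes one
  factor of each pair, so these closure properties need no dimension theory.
  \<open>vec_space_rank_le\<close> converts to the actual rank.\<close>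

definition rank_le :: "nat \<Rightarrow> complex mat \<Rightarrow> nat \<Rightarrow> bool" where
  "rank_le n A r \<longleftrightarrow> A \<in> carrier_mat n n \<and> (\<exists>ps. length ps \<le> r \<and>
     (\<forall>i<n. \<forall>j<n. A $$ (i,j) = (\<Sum>(u,v)\<leftarrow>ps. u i * v j)))"

lemma rank_le_add:
  assumes "rank_le n A r" "rank_le n B s"
  shows "rank_le n (A + B) (r + s)"
proof -
  obtain ps where ps: "length ps \<le> r" "\<And>i j. i < n \<Longrightarrow> j < n \<Longrightarrow> A $$ (i,j) = (\<Sum>(u,v)\<leftarrow>ps. u i * v j)"
    using assms(1) by (auto simp: rank_le_def)
  obtain qs where qs: "length qs \<le> s" "\<And>i j. i < n \<Longrightarrow> j < n \<Longrightarrow> B $$ (i,j) = (\<Sum>(u,v)\<leftarrow>qs. u i * v j)"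
    using assms(2) by (auto simp: rank_le_def)
  show ?thesis
    unfolding rank_le_def using assms ps qs
    by (intro conjI exI[of _ "ps @ qs"]) (auto simp: rank_le_def)
qed

lemma rank_le_mult_left:
  assumes "rank_le n A r" and B: "B \<in> carrier_mat n n"
  shows "rank_le n (B * A) r"
proof -
  obtain ps where ps: "length ps \<le> r" "\<And>i j. i < n \<Longrightarrow> j < n \<Longrightarrow> A $$ (i,j) = (\<Sum>(u,v)\<leftarrow>ps. u i * v j)"
    using assms(1) by (auto simp: rank_le_def)
  have A: "A \<in> carrier_mat n n" using assms(1) by (simp add: rank_le_def)
  let ?g = "\<lambda>(u, v). (\<lambda>i. \<Sum>k<n. B $$ (i,k) * u k, v)"
  have "(B * A) $$ (i,j) = (\<Sum>(u,v)\<leftarrow>map ?g ps. u i * v j)" if ij: "i < n" "j < n" for i j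
  proof -
    have "(B * A) $$ (i,j) = (\<Sum>k<n. B $$ (i,k) * (\<Sum>(u,v)\<leftarrow>ps. u k * v j))"
      using A B ij by (simp add: scalar_prod_def atLeast0LessThan ps)
    also have "\<dots> = (\<Sum>(u,v)\<leftarrow>map ?g ps. u i * v j)"
      by (induction ps) (auto simp: algebra_simps sum.distrib sum_distrib_left sum_distrib_right)
    finally show ?thesis .
  qed
  then show ?thesis
    unfolding rank_le_def using A B ps(1) by (intro conjI exI[of _ "map ?g ps"]) auto
qed

lemma rank_le_mult_right:
  assumes "rank_le n A r" and B: "B \<in> carrier_mat n n"
  shows "rank_le n (A * B) r"
proof -
  obtain ps where ps: "length ps \<le> r" "\<And>i j. i < n \<Longrightarrow> j < n \<Longrightarrow> A $$ (i,j) = (\<Sum>(u,v)\<leftarrow>ps. u i * v j)"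
    using assms(1) by (auto simp: rank_le_def)
  have A: "A \<in> carrier_mat n n" using assms(1) by (simp add: rank_le_def)
  let ?g = "\<lambda>(u, v). (u, \<lambda>j. \<Sum>k<n. v k * B $$ (k,j))"
  have "(A * B) $$ (i,j) = (\<Sum>(u,v)\<leftarrow>map ?g ps. u i * v j)" if ij: "i < n" "j < n" for i j
  proof -
    have "(A * B) $$ (i,j) = (\<Sum>k<n. (\<Sum>(u,v)\<leftarrow>ps. u i * v k) * B $$ (k,j))"
      using A B ij by (simp add: scalar_prod_def atLeast0LessThan ps)
    also have "\<dots> = (\<Sum>(u,v)\<leftarrow>map ?g ps. u i * v j)"
      by (induction ps) (auto simp: algebra_simps sum.distrib sum_distrib_left sum_distrib_right)
    finally show ?thesis .
  qed
  then show ?thesis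
    unfolding rank_le_def using A B ps(1) by (intro conjI exI[of _ "map ?g ps"]) auto
qed

text \<open>Each row that may be nonzero contributes one outer product, of its unit vector with the
  row itself.\<close>

lemma rank_le_rows:
  assumes A: "A \<in> carrier_mat n n" and S: "finite S" "card S \<le> r"
    and zero: "\<And>i j. i < n \<Longrightarrow> j < n \<Longrightarrow> i \<notin> S \<Longrightarrow> A $$ (i,j) = 0"
  shows "rank_le n A r"
proof -
  obtain xs where xs: "set xs = S" "distinct xs" using finite_distinct_list[OF S(1)] by blast
  let ?ps = "map (\<lambda>s. (\<lambda>i. if i = s then 1 else 0, \<lambda>j. A $$ (s,j))) xs"
  have "A $$ (i,j) = (\<Sum>(u,v)\<leftarrow>?ps. u i * v j)" if "i < n" "j < n" for i j
  proof -
    have "(\<Sum>(u,v)\<leftarrow>?ps. u i * v j) = (\<Sum>s\<leftarrow>xs. if i = s then A $$ (s,j) else 0)"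
      by (induction xs) auto
    also have "\<dots> = (\<Sum>s\<in>S. if i = s then A $$ (s,j) else 0)"
      using sum_list_distinct_conv_sum_set[OF xs(2)] xs(1) by metis
    also have "\<dots> = A $$ (i,j)" using zero that S(1) by simp
    finally show ?thesis by simp
  qed
  moreover have "length ?ps \<le> r" using xs S(2) distinct_card by fastforce
  ultimately show ?thesis unfolding rank_le_def using A by (intro conjI exI[of _ ?ps]) auto
qed

lemma vec_space_rank_le:
  assumes "rank_le n A r" shows "vec_space.rank n A \<le> r"
proof -
  interpret vec_space "TYPE(complex)" n .
  have main: "rank (mat n n (\<lambda>(i,j). \<Sum>(u,v)\<leftarrow>ps. u i * v j)) \<le> length ps"
    for ps :: "((nat \<Rightarrow> complex) \<times> (nat \<Rightarrow> complex)) list"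
  proof (induction ps)
    case Nil
    have "mat n n (\<lambda>(i,j). \<Sum>(u :: nat \<Rightarrow> complex, v :: nat \<Rightarrow> complex)\<leftarrow>[]. u i * v j) = 0\<^sub>m n n"
      by (intro eq_matI) auto
    then have "rank (mat n n (\<lambda>(i,j). \<Sum>(u :: nat \<Rightarrow> complex, v :: nat \<Rightarrow> complex)\<leftarrow>[]. u i * v j)) = 0"
      by (simp only: rank_0I)
    then show ?case by (simp only: list.size order_refl)
  next
    case (Cons p ps)
    obtain u v where p: "p = (u, v)" by (cases p)
    let ?P = "mat n n (\<lambda>(i,j). u i * v j)"
    let ?Q = "mat n n (\<lambda>(i,j). \<Sum>(u,v)\<leftarrow>ps. u i * v j)"
    have "mat n n (\<lambda>(i,j). \<Sum>(u,v)\<leftarrow>p # ps. u i * v j) = ?P + ?Q"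
      by (rule eq_matI) (auto simp: p)
    moreover have "rank (?P + ?Q) \<le> rank ?P + rank ?Q"
      by (rule rank_subadditive[of _ n]) auto
    moreover have "rank ?P \<le> 1"
      by (rule rank_le_1_product_entries[of _ n u v]) auto
    ultimately show ?case using Cons by simp
  qed
  obtain ps where ps: "length ps \<le> r" "\<And>i j. i < n \<Longrightarrow> j < n \<Longrightarrow> A $$ (i,j) = (\<Sum>(u,v)\<leftarrow>ps. u i * v j)"
    using assms by (auto simp: rank_le_def)
  have "A = mat n n (\<lambda>(i,j). \<Sum>(u,v)\<leftarrow>ps. u i * v j)"
    using assms ps(2) by (intro eq_matI) (auto simp: rank_le_def)
  then show ?thesis using main[of ps] ps(1) by simp
qed

section \<open>Low rank plus small norm\<close>

text \<open>The analogue of compactness for matrix sequences (finite rank up to small norm), which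
  makes null sequences a two-sided ideal among bounded ones. \<open>M\<close> is quantified before
  \<open>n\<close>, so the rank stays bounded as the size grows.\<close>

definition acs_null :: "(nat \<Rightarrow> complex mat) \<Rightarrow> bool" where
  "acs_null V \<longleftrightarrow> (\<forall>\<epsilon>>0. \<exists>N M. \<forall>n>N. \<exists>R E. R \<in> carrier_mat n n \<and> E \<in> carrier_mat n n \<and>
     V n = R + E \<and> rank_le n R M \<and> opnorm_le E \<epsilon>)"

lemma acs_nullE:
  assumes "acs_null V" "0 < \<epsilon>"
  obtains N M where "\<And>n. n > N \<Longrightarrow> \<exists>R E. R \<in> carrier_mat n n \<and> E \<in> carrier_mat n n \<and>
     V n = R + E \<and> rank_le n R M \<and> opnorm_le E \<epsilon>"
  using assms unfolding acs_null_def by blast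

lemma acs_null_add:
  assumes "acs_null V" "acs_null W"
  shows "acs_null (\<lambda>n. V n + W n)"
  unfolding acs_null_def
proof (intro allI impI)
  fix \<epsilon> :: real assume "0 < \<epsilon>"
  then have e: "0 < \<epsilon> / 2" by simp
  obtain N M where V: "\<And>n. n > N \<Longrightarrow> \<exists>R E. R \<in> carrier_mat n n \<and> E \<in> carrier_mat n n \<and>
     V n = R + E \<and> rank_le n R M \<and> opnorm_le E (\<epsilon> / 2)"
    by (rule acs_nullE[OF assms(1) e]) blast
  obtain N' M' where W: "\<And>n. n > N' \<Longrightarrow> \<exists>R E. R \<in> carrier_mat n n \<and> E \<in> carrier_mat n n \<and>
     W n = R + E \<and> rank_le n R M' \<and> opnorm_le E (\<epsilon> / 2)"
    by (rule acs_nullE[OF assms(2) e]) blast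
  show "\<exists>N M. \<forall>n>N. \<exists>R E. R \<in> carrier_mat n n \<and> E \<in> carrier_mat n n \<and>
     V n + W n = R + E \<and> rank_le n R M \<and> opnorm_le E \<epsilon>"
  proof (rule exI[of _ "max N N'"], rule exI[of _ "M + M'"], intro allI impI)
    fix n assume n: "max N N' < n"
    obtain R E where 1: "R \<in> carrier_mat n n" "E \<in> carrier_mat n n" "V n = R + E" "rank_le n R M"
      "opnorm_le E (\<epsilon> / 2)" using V[of n] n by auto
    obtain R' E' where 2: "R' \<in> carrier_mat n n" "E' \<in> carrier_mat n n" "W n = R' + E'" "rank_le n R' M'"
      "opnorm_le E' (\<epsilon> / 2)" using W[of n] n by auto
    have "V n + W n = (R + R') + (E + E')"
      using 1 2 by (intro eq_matI) auto
    moreover have "rank_le n (R + R') (M + M')" using 1 2 by (intro rank_le_add)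
    moreover have "opnorm_le (E + E') \<epsilon>" using opnorm_le_add[OF 1(2) 2(2) 1(5) 2(5)] by simp
    ultimately show "\<exists>R E. R \<in> carrier_mat n n \<and> E \<in> carrier_mat n n \<and>
       V n + W n = R + E \<and> rank_le n R (M + M') \<and> opnorm_le E \<epsilon>"
      using 1 2 by (intro exI[of _ "R + R'"] exI[of _ "E + E'"]) auto
  qed
qed

lemma acs_null_mult_left:
  assumes null: "acs_null V" and X: "\<And>n. X n \<in> carrier_mat n n" "\<And>n. opnorm_le (X n) B"
  shows "acs_null (\<lambda>n. X n * V n)"
  unfolding acs_null_def
proof (intro allI impI)
  fix \<epsilon> :: real assume \<epsilon>: "0 < \<epsilon>"
  \<comment> \<open>Enlarging the bound to a positive one permits asking for an error of
    \<open>\<epsilon> / b\<close>, which the factor restores to \<open>\<epsilon>\<close>.\<close>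
  define b where "b = max B 1"
  have b: "0 < b" and Xb: "opnorm_le (X n) b" for n
    using opnorm_le_mono[OF X(2)[of n]] by (auto simp: b_def)
  obtain N M where V: "\<And>n. n > N \<Longrightarrow> \<exists>R E. R \<in> carrier_mat n n \<and> E \<in> carrier_mat n n \<and>
     V n = R + E \<and> rank_le n R M \<and> opnorm_le E (\<epsilon> / b)"
    by (rule acs_nullE[OF null, of "\<epsilon> / b"]) (use \<epsilon> b in auto)
  show "\<exists>N M. \<forall>n>N. \<exists>R E. R \<in> carrier_mat n n \<and> E \<in> carrier_mat n n \<and>
     X n * V n = R + E \<and> rank_le n R M \<and> opnorm_le E \<epsilon>"
  proof (rule exI[of _ N], rule exI[of _ M], intro allI impI)
    fix n assume n: "N < n"
    obtain R E where 1: "R \<in> carrier_mat n n" "E \<in> carrier_mat n n" "V n = R + E" "rank_le n R M"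
      "opnorm_le E (\<epsilon> / b)" using V[OF n] by auto
    have "X n * V n = X n * R + X n * E"
      using mult_add_distrib_mat[OF X(1) 1(1) 1(2)] 1 by simp
    moreover have "rank_le n (X n * R) M" using 1 X by (intro rank_le_mult_left)
    moreover have "opnorm_le (X n * E) \<epsilon>"
      using opnorm_le_mult[OF X(1)[of n] 1(2) Xb 1(5)] b by simp
    ultimately show "\<exists>R E. R \<in> carrier_mat n n \<and> E \<in> carrier_mat n n \<and>
       X n * V n = R + E \<and> rank_le n R M \<and> opnorm_le E \<epsilon>"
      using 1 X(1)[of n] by (intro exI[of _ "X n * R"] exI[of _ "X n * E"]) auto
  qed
qed

lemma acs_null_mult_right:
  assumes null: "acs_null V" and X: "\<And>n. X n \<in> carrier_mat n n" "\<And>n. opnorm_le (X n) B"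
  shows "acs_null (\<lambda>n. V n * X n)"
  unfolding acs_null_def
proof (intro allI impI)
  fix \<epsilon> :: real assume \<epsilon>: "0 < \<epsilon>"
  define b where "b = max B 1"
  have b: "0 < b" and Xb: "opnorm_le (X n) b" for n
    using opnorm_le_mono[OF X(2)[of n]] by (auto simp: b_def)
  obtain N M where V: "\<And>n. n > N \<Longrightarrow> \<exists>R E. R \<in> carrier_mat n n \<and> E \<in> carrier_mat n n \<and>
     V n = R + E \<and> rank_le n R M \<and> opnorm_le E (\<epsilon> / b)"
    by (rule acs_nullE[OF null, of "\<epsilon> / b"]) (use \<epsilon> b in auto)
  show "\<exists>N M. \<forall>n>N. \<exists>R E. R \<in> carrier_mat n n \<and> E \<in> carrier_mat n n \<and>
     V n * X n = R + E \<and> rank_le n R M \<and> opnorm_le E \<epsilon>"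
  proof (rule exI[of _ N], rule exI[of _ M], intro allI impI)
    fix n assume n: "N < n"
    obtain R E where 1: "R \<in> carrier_mat n n" "E \<in> carrier_mat n n" "V n = R + E" "rank_le n R M"
      "opnorm_le E (\<epsilon> / b)" using V[OF n] by auto
    have "V n * X n = R * X n + E * X n"
      using add_mult_distrib_mat[OF 1(1) 1(2) X(1)] 1 by simp
    moreover have "rank_le n (R * X n) M" using 1 X by (intro rank_le_mult_right)
    moreover have "opnorm_le (E * X n) \<epsilon>"
      using opnorm_le_mult[OF 1(2) X(1)[of n] 1(5) Xb] b \<epsilon> by simp
    ultimately show "\<exists>R E. R \<in> carrier_mat n n \<and> E \<in> carrier_mat n n \<and>
       V n * X n = R + E \<and> rank_le n R M \<and> opnorm_le E \<epsilon>"
      using 1 X(1)[of n] by (intro exI[of _ "R * X n"] exI[of _ "E * X n"]) auto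
  qed
qed

text \<open>The low-rank part of the approximant is kept and the distance to it joins the small
  part. This requires the distance bound to be uniform in \<open>n\<close>.\<close>

lemma acs_null_limit:
  assumes V: "\<And>n. V n \<in> carrier_mat n n"
    and approx: "\<And>\<delta>. 0 < \<delta> \<Longrightarrow> \<exists>W. acs_null W \<and> (\<forall>n. W n \<in> carrier_mat n n \<and> opnorm_le (V n - W n) \<delta>)"
  shows "acs_null V"
  unfolding acs_null_def
proof (intro allI impI)
  fix \<epsilon> :: real assume "0 < \<epsilon>"
  then have e: "0 < \<epsilon> / 2" by simp
  obtain W where null: "acs_null W"
    and W: "\<And>n. W n \<in> carrier_mat n n" "\<And>n. opnorm_le (V n - W n) (\<epsilon> / 2)"
    using approx[OF e] by blast
  obtain N M where N: "\<And>n. n > N \<Longrightarrow> \<exists>R E. R \<in> carrier_mat n n \<and> E \<in> carrier_mat n n \<and>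
     W n = R + E \<and> rank_le n R M \<and> opnorm_le E (\<epsilon> / 2)"
    by (rule acs_nullE[OF null e]) blast
  show "\<exists>N M. \<forall>n>N. \<exists>R E. R \<in> carrier_mat n n \<and> E \<in> carrier_mat n n \<and>
     V n = R + E \<and> rank_le n R M \<and> opnorm_le E \<epsilon>"
  proof (rule exI[of _ N], rule exI[of _ M], intro allI impI)
    fix n assume n: "N < n"
    obtain R E where 1: "R \<in> carrier_mat n n" "E \<in> carrier_mat n n" "W n = R + E" "rank_le n R M"
      "opnorm_le E (\<epsilon> / 2)" using N[OF n] by auto
    have "V n = R + (E + (V n - W n))"
      using 1 V[of n] W(1)[of n] by (intro eq_matI) auto
    moreover have "opnorm_le (E + (V n - W n)) \<epsilon>"
      using opnorm_le_add[OF 1(2) minus_carrier_mat[OF W(1)] 1(5) W(2)] by simp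
    ultimately show "\<exists>R E. R \<in> carrier_mat n n \<and> E \<in> carrier_mat n n \<and>
       V n = R + E \<and> rank_le n R M \<and> opnorm_le E \<epsilon>"
      using 1 V[of n] W(1)[of n] by (intro exI[of _ R] exI[of _ "E + (V n - W n)"]) auto
  qed
qed

lemma acs_null_zero: "acs_null (\<lambda>n. 0\<^sub>m n n)"
  unfolding acs_null_def
proof (intro allI impI)
  fix \<epsilon> :: real assume "0 < \<epsilon>"
  then have "rank_le n (0\<^sub>m n n) 0 \<and> opnorm_le (0\<^sub>m n n) \<epsilon>" for n
    by (auto simp: rank_le_def opnorm_le_def vec_norm2_def sum_nonneg)
  then show "\<exists>N M. \<forall>n>N. \<exists>R E. R \<in> carrier_mat n n \<and> E \<in> carrier_mat n n \<and>
     0\<^sub>m n n = R + E \<and> rank_le n R M \<and> opnorm_le E \<epsilon>"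
    by (intro exI[of _ 0] allI impI exI[of _ "0\<^sub>m n n" for n]) auto
qed

text \<open>A scalar acts as multiplication by a bounded multiple of the identity.\<close>

lemma acs_null_smult:
  assumes "acs_null V" "\<And>n. V n \<in> carrier_mat n n"
  shows "acs_null (\<lambda>n. c \<cdot>\<^sub>m V n)"
proof -
  have "acs_null (\<lambda>n. (c \<cdot>\<^sub>m 1\<^sub>m n) * V n)"
    by (rule acs_null_mult_left[OF assms(1), where B = "cmod c * 1"])
       (use opnorm_le_smult[OF opnorm_le_one] in auto)
  moreover have "(c \<cdot>\<^sub>m 1\<^sub>m n) * V n = c \<cdot>\<^sub>m V n" for n
    using assms(2)[of n] by (subst mult_smult_assoc_mat[of _ n n _ n]) auto
  ultimately show ?thesis by simp
qed

section \<open>The matrix sine\<close>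

text \<open>Inserting \<open>X\<^sup>k Y\<close> gives the step identity without commutativity; its
  two summands have the null factor on the right and on the left, so both ideal properties are
  needed.\<close>

lemma acs_null_pow_diff:
  assumes null: "acs_null (\<lambda>n. X n - Y n)"
    and X: "\<And>n. X n \<in> carrier_mat n n" "\<And>n. opnorm_le (X n) B"
    and Y: "\<And>n. Y n \<in> carrier_mat n n" "\<And>n. opnorm_le (Y n) B"
    and B: "0 \<le> B"
  shows "acs_null (\<lambda>n. X n ^\<^sub>m k - Y n ^\<^sub>m k)"
proof (induction k)
  case 0
  have "X n ^\<^sub>m 0 - Y n ^\<^sub>m 0 = 0\<^sub>m n n" for n
    using X(1)[of n] Y(1)[of n] by (intro eq_matI) auto
  then show ?case using acs_null_zero by simp
next
  case (Suc k)
  have "X n ^\<^sub>m Suc k - Y n ^\<^sub>m Suc k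
      = X n ^\<^sub>m k * (X n - Y n) + (X n ^\<^sub>m k - Y n ^\<^sub>m k) * Y n" for n
  proof -
    have P: "X n ^\<^sub>m k \<in> carrier_mat n n" "Y n ^\<^sub>m k \<in> carrier_mat n n"
      using X(1)[of n] Y(1)[of n] by auto
    have "X n ^\<^sub>m k * (X n - Y n) = X n ^\<^sub>m k * X n - X n ^\<^sub>m k * Y n"
      using mult_minus_distrib_mat[OF P(1) X(1) Y(1)] .
    moreover have "(X n ^\<^sub>m k - Y n ^\<^sub>m k) * Y n = X n ^\<^sub>m k * Y n - Y n ^\<^sub>m k * Y n"
      using minus_mult_distrib_mat[OF P Y(1)] .
    moreover have "P - R = (P - Q) + (Q - R)"
      if "P \<in> carrier_mat n n" "Q \<in> carrier_mat n n" "R \<in> carrier_mat n n" for P Q R :: "complex mat"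
      using that by (intro eq_matI) auto
    note this[OF mult_carrier_mat[OF P(1) X(1)] mult_carrier_mat[OF P(1) Y(1)] mult_carrier_mat[OF P(2) Y(1)]]
    ultimately show ?thesis by simp
  qed
  moreover have "acs_null (\<lambda>n. X n ^\<^sub>m k * (X n - Y n))"
    by (rule acs_null_mult_left[OF null, where B = "B ^ k"])
       (auto intro!: opnorm_le_pow[OF X B] pow_carrier_mat[OF X(1)])
  moreover have "acs_null (\<lambda>n. (X n ^\<^sub>m k - Y n ^\<^sub>m k) * Y n)"
    by (rule acs_null_mult_right[OF Suc Y])
  ultimately show ?case using acs_null_add by simp
qed

text \<open>An arbitrary index set lets the truncation \<open>{..<D}\<close> and the tail sections
  \<open>{D..<d + D}\<close> share the same lemmas.\<close>

definition sin_terms :: "nat set \<Rightarrow> complex mat \<Rightarrow> complex mat" where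
  "sin_terms I X = mat (dim_row X) (dim_col X)
     (\<lambda>(i,j). \<Sum>m\<in>I. ((-1) ^ m / fact (2*m+1)) * (X ^\<^sub>m (2*m+1)) $$ (i,j))"

lemma sin_terms_carrier [simp]: "X \<in> carrier_mat n n \<Longrightarrow> sin_terms I X \<in> carrier_mat n n"
  by (simp add: sin_terms_def)

lemma mat_sin_carrier [simp]: "X \<in> carrier_mat n n \<Longrightarrow> mat_sin X \<in> carrier_mat n n"
  by (simp add: mat_sin_def)

lemma sin_terms_empty: "X \<in> carrier_mat n n \<Longrightarrow> sin_terms {} X = 0\<^sub>m n n"
  by (intro eq_matI) (auto simp: sin_terms_def)

lemma sin_terms_insert:
  assumes "X \<in> carrier_mat n n" "finite I" "m \<notin> I"
  shows "sin_terms (insert m I) X = ((-1) ^ m / fact (2*m+1)) \<cdot>\<^sub>m X ^\<^sub>m (2*m+1) + sin_terms I X"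
  using assms pow_carrier_mat[OF assms(1), of "2*m+1"]
  by (intro eq_matI) (auto simp: sin_terms_def simp del: pow_mat.simps)

lemma opnorm_le_sin_terms:
  assumes X: "X \<in> carrier_mat n n" "opnorm_le X B" "0 \<le> B" and "finite I"
  shows "opnorm_le (sin_terms I X) (\<Sum>m\<in>I. B ^ (2*m+1) / fact (2*m+1))"
  using \<open>finite I\<close>
proof (induction I rule: finite_induct)
  case empty
  then show ?case
    using X(1) by (auto simp: sin_terms_empty opnorm_le_def vec_norm2_def)
next
  case (insert m I)
  have "cmod ((-1) ^ m / fact (2*m+1)) * B ^ (2*m+1) = B ^ (2*m+1) / fact (2*m+1)"
    by (simp add: norm_divide norm_power del: fact_Suc power_Suc)
  then have "opnorm_le (((-1) ^ m / fact (2*m+1)) \<cdot>\<^sub>m X ^\<^sub>m (2*m+1)) (B ^ (2*m+1) / fact (2*m+1))"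
    using opnorm_le_smult[OF opnorm_le_pow[OF X], of "(-1) ^ m / fact (2*m+1)" "2*m+1"] by metis
  then show ?case
    unfolding sin_terms_insert[OF X(1) insert(1,2)] sum.insert[OF insert(1,2)]
    using X insert(3) pow_carrier_mat[OF X(1), of "2*m+1"]
    by (intro opnorm_le_add[of _ n]) (auto simp del: pow_mat.simps)
qed

section \<open>Convergence and uniform truncation of the sine series\<close>

lemma summable_odd_exp_terms: "summable (\<lambda>m. (B::real) ^ (2*m+1) / fact (2*m+1))"
proof -
  \<comment> \<open>With absolute values the exponential series has nonnegative terms, so any
    injectively indexed subseries, here the odd one, is summable.\<close>
  have "summable (\<lambda>k. \<bar>B\<bar> ^ k / fact k)"
    using summable_exp[of "\<bar>B\<bar>"] by (simp add: divide_inverse mult.commute)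
  then have "summable ((\<lambda>k. \<bar>B\<bar> ^ k / fact k) \<circ> (\<lambda>m. 2*m+1))"
    by (rule summable_reindex) (auto simp: inj_def)
  moreover have "\<bar>B\<bar> ^ (2*m+1) / fact (2*m+1) = norm (B ^ (2*m+1) / fact (2*m+1))" for m
    by (simp add: abs_divide abs_mult power_abs del: fact_Suc)
  ultimately have "summable (\<lambda>m. norm (B ^ (2*m+1) / fact (2*m+1)))"
    by (simp only: o_def)
  then show ?thesis by (rule summable_norm_cancel)
qed

lemma mat_sin_sums:
  assumes X: "X \<in> carrier_mat n n" "opnorm_le X B" "0 \<le> B" and ij: "i < n" "j < n"
  shows "(\<lambda>m. ((-1) ^ m / fact (2*m+1)) * (X ^\<^sub>m (2*m+1)) $$ (i,j)) sums (mat_sin X $$ (i,j))"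
proof -
  have "norm (((-1) ^ m / fact (2*m+1)) * (X ^\<^sub>m (2*m+1)) $$ (i,j)) \<le> B ^ (2*m+1) / fact (2*m+1)" for m
    using cmod_entry_le_opnorm[OF pow_carrier_mat[OF X(1)] opnorm_le_pow[OF X] ij, of "2*m+1"]
    by (simp add: norm_mult norm_divide norm_power divide_right_mono del: fact_Suc power_Suc pow_mat.simps)
  then have "summable (\<lambda>m. ((-1) ^ m / fact (2*m+1)) * (X ^\<^sub>m (2*m+1)) $$ (i,j))"
    by (intro summable_comparison_test'[OF summable_odd_exp_terms[of B], of 0]) blast
  then show ?thesis using X(1) ij by (simp add: mat_sin_def summable_sums)
qed

text \<open>The scalar series at \<open>B\<close> dominates the matrix series, so one cut-off
  \<open>D\<close> serves every size \<open>n\<close> and every matrix bounded by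
  \<open>B\<close>.\<close>

lemma mat_sin_truncation:
  assumes B: "0 \<le> B" and \<epsilon>: "0 < (\<epsilon>::real)"
  obtains D where "\<And>n X. X \<in> carrier_mat n n \<Longrightarrow> opnorm_le X B \<Longrightarrow>
    opnorm_le (mat_sin X - sin_terms {..<D} X) \<epsilon>"
proof -
  obtain D where D: "\<And>d. norm (\<Sum>m=D..<d. B ^ (2*m+1) / fact (2*m+1)) < \<epsilon>"
    using summable_odd_exp_terms[of B, unfolded summable_Cauchy] \<epsilon> by blast
  have "opnorm_le (mat_sin X - sin_terms {..<D} X) \<epsilon>"
    if X: "X \<in> carrier_mat n n" "opnorm_le X B" for n X
  \<comment> \<open>Finite sections of the tail obey the Cauchy bound and converge entrywise to the
    truncation error; the upper end \<open>d + D\<close> keeps every section a genuine difference of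
    partial sums.\<close>
  proof (rule opnorm_le_limit[where S = "\<lambda>d. sin_terms {D..<d + D} X"])
    show "mat_sin X - sin_terms {..<D} X \<in> carrier_mat n n"
      using X(1) minus_carrier_mat sin_terms_carrier by blast
    show "sin_terms {D..<d + D} X \<in> carrier_mat n n" for d using X by simp
    show "opnorm_le (sin_terms {D..<d + D} X) \<epsilon>" for d
      using opnorm_le_mono[OF opnorm_le_sin_terms[OF X B, of "{D..<d + D}"], of \<epsilon>] D[of "d + D"]
      by simp
    fix i j assume ij: "i < n" "j < n"
    let ?g = "\<lambda>m. ((-1) ^ m / fact (2*m+1)) * (X ^\<^sub>m (2*m+1)) $$ (i,j)"
    have "(\<lambda>d. sum ?g {..<d + D} - sum ?g {..<D}) \<longlonglongrightarrow> mat_sin X $$ (i,j) - sum ?g {..<D}"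
      using mat_sin_sums[OF X B ij] unfolding sums_def
      by (intro tendsto_diff tendsto_const LIMSEQ_ignore_initial_segment)
    moreover have "sum ?g {..<d + D} - sum ?g {..<D} = sin_terms {D..<d + D} X $$ (i,j)" for d
    proof -
      have "sum g {..<d + D} - sum g {..<D} = sum g {D..<d + D}" for g :: "nat \<Rightarrow> complex"
        using sum.atLeastLessThan_concat[of 0 D "d + D" g]
        by (simp add: atLeast0LessThan algebra_simps)
      then show ?thesis using X(1) ij by (simp add: sin_terms_def)
    qed
    moreover have "(mat_sin X - sin_terms {..<D} X) $$ (i,j) = mat_sin X $$ (i,j) - sum ?g {..<D}"
      using X(1) ij by (simp add: sin_terms_def)
    ultimately show "(\<lambda>d. sin_terms {D..<d + D} X $$ (i,j))
        \<longlonglongrightarrow> (mat_sin X - sin_terms {..<D} X) $$ (i,j)"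
      by simp
  qed
  then show ?thesis using that by blast
qed

lemma acs_null_mat_sin_diff:
  assumes null: "acs_null (\<lambda>n. X n - Y n)"
    and X: "\<And>n. X n \<in> carrier_mat n n" "\<And>n. opnorm_le (X n) B"
    and Y: "\<And>n. Y n \<in> carrier_mat n n" "\<And>n. opnorm_le (Y n) B"
    and B: "0 \<le> B"
  shows "acs_null (\<lambda>n. mat_sin (X n) - mat_sin (Y n))"
proof (rule acs_null_limit)
  show "mat_sin (X n) - mat_sin (Y n) \<in> carrier_mat n n" for n
    using X(1) Y(1) mat_sin_carrier minus_carrier_mat by blast
  fix \<delta> :: real assume "0 < \<delta>"
  then have "0 < \<delta> / 2" by simp
  then obtain D where D: "\<And>n X. X \<in> carrier_mat n n \<Longrightarrow> opnorm_le X B \<Longrightarrow>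
      opnorm_le (mat_sin X - sin_terms {..<D} X) (\<delta> / 2)"
    using mat_sin_truncation[OF B] by blast
  let ?W = "\<lambda>D n. sin_terms {..<D} (X n) - sin_terms {..<D} (Y n)"
  \<comment> \<open>For a fixed cut-off this is a finite combination of differences of powers; the
    two tails cost \<open>\<delta> / 2\<close> each.\<close>
  have "acs_null (?W D)"
  proof (induction D)
    case 0
    have "?W 0 n = 0\<^sub>m n n" for n
      using sin_terms_empty[OF X(1)[of n]] sin_terms_empty[OF Y(1)[of n]] by simp
    then show ?case using acs_null_zero by simp
  next
    case (Suc D)
    let ?c = "(-1) ^ D / fact (2*D+1) :: complex"
    have "?W (Suc D) n = ?c \<cdot>\<^sub>m (X n ^\<^sub>m (2*D+1) - Y n ^\<^sub>m (2*D+1)) + ?W D n" for n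
    proof -
      have "(?c \<cdot>\<^sub>m P + S) - (?c \<cdot>\<^sub>m Q + T) = ?c \<cdot>\<^sub>m (P - Q) + (S - T)"
        if "P \<in> carrier_mat n n" "Q \<in> carrier_mat n n" "S \<in> carrier_mat n n" "T \<in> carrier_mat n n"
        for P Q S T
        using that by (intro eq_matI) (auto simp: right_diff_distrib)
      note this[OF pow_carrier_mat[OF X(1)] pow_carrier_mat[OF Y(1)]
          sin_terms_carrier[OF X(1)] sin_terms_carrier[OF Y(1)]]
      then show ?thesis
        using sin_terms_insert[OF X(1)[of n], of "{..<D}" D] sin_terms_insert[OF Y(1)[of n], of "{..<D}" D]
        by (simp only: lessThan_Suc finite_lessThan lessThan_iff less_irrefl not_False_eq_True)
    qed
    moreover have "acs_null (\<lambda>n. ?c \<cdot>\<^sub>m (X n ^\<^sub>m (2*D+1) - Y n ^\<^sub>m (2*D+1)))"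
      using X(1) Y(1) by (intro acs_null_smult acs_null_pow_diff[OF null X Y B] minus_carrier_mat pow_carrier_mat)
    ultimately show ?case using acs_null_add[OF _ Suc] by simp
  qed
  moreover have "opnorm_le ((mat_sin (X n) - mat_sin (Y n)) - ?W D n) \<delta>" for n
  proof -
    note C = X(1)[of n] Y(1)[of n]
    let ?a = "mat_sin (X n) - sin_terms {..<D} (X n)" and ?b = "mat_sin (Y n) - sin_terms {..<D} (Y n)"
    have "(mat_sin (X n) - mat_sin (Y n)) - ?W D n = ?a - ?b"
      using mat_sin_carrier[OF C(1)] mat_sin_carrier[OF C(2)]
        sin_terms_carrier[OF C(1), of "{..<D}"] sin_terms_carrier[OF C(2), of "{..<D}"]
      by (intro eq_matI) auto
    moreover have "opnorm_le (?a - ?b) (\<delta> / 2 + \<delta> / 2)"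
      using C by (intro opnorm_le_diff[of _ n] D X Y minus_carrier_mat sin_terms_carrier)
    ultimately show ?thesis by simp
  qed
  moreover have "?W D n \<in> carrier_mat n n" for n
    using X(1) Y(1) by (intro minus_carrier_mat sin_terms_carrier)
  ultimately show "\<exists>W. acs_null W \<and> (\<forall>n. W n \<in> carrier_mat n n \<and>
      opnorm_le (mat_sin (X n) - mat_sin (Y n) - W n) \<delta>)"
    by blast
qed

section \<open>Fourier coefficients\<close>

definition fourier_mode :: "int \<Rightarrow> real \<Rightarrow> complex" where
  "fourier_mode k \<theta> = exp (\<i> * of_int k * of_real \<theta>)"

lemma continuous_on_fourier_mode [continuous_intros]: "continuous_on S (fourier_mode k)"
  unfolding fourier_mode_def by (intro continuous_intros)

lemma fourier_mode_mult: "fourier_mode j \<theta> * fourier_mode k \<theta> = fourier_mode (j + k) \<theta>"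
  by (simp add: fourier_mode_def algebra_simps flip: exp_add)

lemma cnj_fourier_mode: "cnj (fourier_mode k \<theta>) = fourier_mode (- k) \<theta>"
  by (simp add: fourier_mode_def exp_cnj)

lemma fourier_mode_integral:
  "(fourier_mode k has_integral (if k = 0 then of_real (2 * pi) else 0)) {-pi..pi}"
proof (cases "k = 0")
  case True
  then show ?thesis
    using has_integral_const_real[of "1::complex" "-pi" pi]
    by (simp add: fourier_mode_def[abs_def] scaleR_conv_of_real)
next
  case False
  let ?F = "\<lambda>\<theta>. exp (\<i> * of_int k * of_real \<theta>) / (\<i> * of_int k)"
  have "(?F has_vector_derivative fourier_mode k \<theta>) (at \<theta> within {-pi..pi})" for \<theta>
    unfolding fourier_mode_def using False
    by (auto intro!: derivative_eq_intros has_vector_derivative_real_field)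
  then have "(fourier_mode k has_integral (?F pi - ?F (-pi))) {-pi..pi}"
    by (intro fundamental_theorem_of_calculus) auto
  moreover have "exp (\<i> * of_int k * of_real pi) = exp (\<i> * of_int k * of_real (-pi))"
    by (subst exp_eq) (auto intro!: exI[of _ k] simp: algebra_simps)
  ultimately show ?thesis using False by simp
qed

text \<open>Phrased with \<open>has_integral\<close> and cleared of the denominator, so that
  integrability travels along and linearity of the coefficients follows from linearity of the
  integral.\<close>

lemma fourier_coeff_integral:
  assumes "continuous_on UNIV f"
  shows "((\<lambda>\<theta>. f \<theta> * fourier_mode (- k) \<theta>) has_integral (of_real (2 * pi) * fourier_coeff f k)) {-pi..pi}"
proof -
  have "(\<lambda>\<theta>. f \<theta> * fourier_mode (- k) \<theta>) integrable_on {-pi..pi}"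
    by (intro integrable_continuous_real continuous_intros continuous_on_subset[OF assms]) auto
  then show ?thesis
    by (simp add: fourier_coeff_def fourier_mode_def has_integral_integral)
qed

lemma fourier_coeffI:
  assumes "((\<lambda>\<theta>. f \<theta> * fourier_mode (- k) \<theta>) has_integral (of_real (2 * pi) * c)) {-pi..pi}"
  shows "fourier_coeff f k = c"
  using integral_unique[OF assms] by (simp add: fourier_coeff_def fourier_mode_def)

lemma fourier_coeff_add:
  assumes "continuous_on UNIV f" "continuous_on UNIV g"
  shows "fourier_coeff (\<lambda>\<theta>. f \<theta> + g \<theta>) k = fourier_coeff f k + fourier_coeff g k"
  using has_integral_add[OF fourier_coeff_integral[OF assms(1)] fourier_coeff_integral[OF assms(2)]]
  by (intro fourier_coeffI) (simp add: distrib_left distrib_right)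

lemma fourier_coeff_diff:
  assumes "continuous_on UNIV f" "continuous_on UNIV g"
  shows "fourier_coeff (\<lambda>\<theta>. f \<theta> - g \<theta>) k = fourier_coeff f k - fourier_coeff g k"
  using has_integral_diff[OF fourier_coeff_integral[OF assms(1)] fourier_coeff_integral[OF assms(2)]]
  by (intro fourier_coeffI) (simp add: left_diff_distrib right_diff_distrib)

lemma fourier_coeff_mode: "fourier_coeff (\<lambda>\<theta>. c * fourier_mode k \<theta>) m = (if m = k then c else 0)"
proof (rule fourier_coeffI)
  have "((\<lambda>\<theta>. c * fourier_mode (k - m) \<theta>) has_integral
      (c * (if k - m = 0 then of_real (2 * pi) else 0))) {-pi..pi}"
    by (intro has_integral_mult_right fourier_mode_integral)
  moreover have "c * (if k - m = 0 then of_real (2 * pi) else 0) = of_real (2 * pi) * (if m = k then c else 0)"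
    by simp
  moreover have "c * fourier_mode (k - m) \<theta> = c * fourier_mode k \<theta> * fourier_mode (- m) \<theta>" for \<theta>
    by (simp add: mult.assoc fourier_mode_mult)
  ultimately show "((\<lambda>\<theta>. c * fourier_mode k \<theta> * fourier_mode (- m) \<theta>) has_integral
      (of_real (2 * pi) * (if m = k then c else 0))) {-pi..pi}"
    by (simp only:)
qed

section \<open>Toeplitz matrices and the optimal circulant\<close>

text \<open>Expanding the squared modulus as a double sum, orthogonality of the modes keeps only the
  diagonal terms.\<close>

lemma Parseval_fourier_modes:
  "((\<lambda>\<theta>. (cmod (\<Sum>k<n. x k * fourier_mode (int k) \<theta>))\<^sup>2) has_integral
      (2 * pi * (\<Sum>k<n. (cmod (x k))\<^sup>2))) {-pi..pi}"
proof -
  let ?Q = "\<lambda>\<theta>. \<Sum>k<n. x k * fourier_mode (int k) \<theta>"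
  have "((\<lambda>\<theta>. \<Sum>j<n. \<Sum>k<n. (x j * cnj (x k)) * fourier_mode (int j - int k) \<theta>) has_integral
      (\<Sum>j<n. \<Sum>k<n. (x j * cnj (x k)) * (if int j - int k = 0 then of_real (2 * pi) else 0))) {-pi..pi}"
    by (intro has_integral_sum has_integral_mult_right fourier_mode_integral) auto
  moreover have "(\<Sum>j<n. \<Sum>k<n. (x j * cnj (x k)) * fourier_mode (int j - int k) \<theta>) = of_real ((cmod (?Q \<theta>))\<^sup>2)" for \<theta>
  proof -
    have "(x j * cnj (x k)) * fourier_mode (int j - int k) \<theta>
        = (x j * fourier_mode (int j) \<theta>) * (cnj (x k) * fourier_mode (- int k) \<theta>)" for j k
      using fourier_mode_mult[of "int j" \<theta> "- int k"] by (simp add: mult_ac)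
    then have "(\<Sum>j<n. \<Sum>k<n. (x j * cnj (x k)) * fourier_mode (int j - int k) \<theta>)
        = ?Q \<theta> * (\<Sum>k<n. cnj (x k) * fourier_mode (- int k) \<theta>)"
      unfolding sum_product by (intro sum.cong refl)
    also have "\<dots> = ?Q \<theta> * cnj (?Q \<theta>)"
      by (simp add: cnj_fourier_mode)
    finally show ?thesis
      by (simp only: complex_norm_square)
  qed
  moreover have "(\<Sum>j<n. \<Sum>k<n. (x j * cnj (x k)) * (if int j - int k = 0 then of_real (2 * pi) else 0))
      = of_real (2 * pi * (\<Sum>k<n. (cmod (x k))\<^sup>2))"
  proof -
    have "(\<Sum>k<n. (x j * cnj (x k)) * (if int j - int k = 0 then of_real (2 * pi) else 0))
        = of_real (2 * pi * (cmod (x j))\<^sup>2)" if "j < n" for j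
    proof -
      have "(\<Sum>k<n. (x j * cnj (x k)) * (if int j - int k = 0 then of_real (2 * pi) else 0))
          = (\<Sum>k<n. if j = k then x j * cnj (x j) * of_real (2 * pi) else 0)"
        by (intro sum.cong) auto
      also have "\<dots> = of_real (2 * pi) * (x j * cnj (x j))"
        using that by simp
      finally show ?thesis by (simp only: of_real_mult complex_norm_square)
    qed
    then show ?thesis unfolding sum_distrib_left of_real_sum by (intro sum.cong) auto
  qed
  ultimately have "((\<lambda>\<theta>. complex_of_real ((cmod (?Q \<theta>))\<^sup>2)) has_integral
      complex_of_real (2 * pi * (\<Sum>k<n. (cmod (x k))\<^sup>2))) {-pi..pi}"
    by (simp only:)
  from has_integral_linear[OF this bounded_linear_Re] show ?thesis
    by (simp only: o_def Re_complex_of_real)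
qed

text \<open>Up to the factor \<open>2 * pi\<close>, the form is the integral of \<open>f\<close>
  times two trigonometric polynomials with coefficients \<open>x\<close> and \<open>y\<close>.
  Bounding \<open>f\<close> pointwise and the product by half the sum of squares leaves two Parseval
  integrals.\<close>

lemma form_le_toeplitz:
  assumes f: "continuous_on UNIV f" and bound: "\<And>\<theta>. cmod (f \<theta>) \<le> B"
  shows "form_le n (\<lambda>j k. fourier_coeff f (int j - int k)) B"
  unfolding form_le_def
proof (intro allI)
  fix x y :: "nat \<Rightarrow> complex"
  let ?Q = "\<lambda>x \<theta>. \<Sum>k<n. x k * fourier_mode (int k) \<theta>"
  \<comment> \<open>The form does not conjugate \<open>y\<close> while its frequencies are
    \<open>-j\<close>; conjugating twice turns it into a polynomial with frequencies
    \<open>j\<close>, to which Parseval applies.\<close>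
  let ?P = "\<lambda>\<theta>. cnj (?Q (\<lambda>j. cnj (y j)) \<theta>)"
  let ?S = "\<Sum>j<n. \<Sum>k<n. y j * fourier_coeff f (int j - int k) * x k"
  have "((\<lambda>\<theta>. \<Sum>j<n. \<Sum>k<n. (y j * x k) * (f \<theta> * fourier_mode (- (int j - int k)) \<theta>)) has_integral
      (\<Sum>j<n. \<Sum>k<n. (y j * x k) * (of_real (2 * pi) * fourier_coeff f (int j - int k)))) {-pi..pi}"
    by (intro has_integral_sum has_integral_mult_right fourier_coeff_integral f) auto
  moreover have "(\<Sum>j<n. \<Sum>k<n. (y j * x k) * (f \<theta> * fourier_mode (- (int j - int k)) \<theta>))
      = f \<theta> * ?P \<theta> * ?Q x \<theta>" for \<theta>
  proof -
    have "(y j * x k) * (f \<theta> * fourier_mode (- (int j - int k)) \<theta>)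
        = f \<theta> * ((y j * fourier_mode (- int j) \<theta>) * (x k * fourier_mode (int k) \<theta>))" for j k
      using fourier_mode_mult[of "- int j" \<theta> "int k"] by (simp add: mult_ac)
    then have "(\<Sum>j<n. \<Sum>k<n. (y j * x k) * (f \<theta> * fourier_mode (- (int j - int k)) \<theta>))
        = f \<theta> * ((\<Sum>j<n. y j * fourier_mode (- int j) \<theta>) * ?Q x \<theta>)"
      unfolding sum_product by (simp only: sum_distrib_left)
    also have "\<dots> = f \<theta> * (?P \<theta> * ?Q x \<theta>)"
      by (simp add: cnj_fourier_mode)
    finally show ?thesis by (simp only: mult.assoc)
  qed
  moreover have "(\<Sum>j<n. \<Sum>k<n. (y j * x k) * (of_real (2 * pi) * fourier_coeff f (int j - int k)))
      = of_real (2 * pi) * ?S"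
    by (simp add: sum_distrib_left mult_ac)
  ultimately have I: "((\<lambda>\<theta>. f \<theta> * ?P \<theta> * ?Q x \<theta>) has_integral (of_real (2 * pi) * ?S)) {-pi..pi}"
    by (simp only:)
  have "((\<lambda>\<theta>. B / 2 * ((cmod (?Q x \<theta>))\<^sup>2 + (cmod (?Q (\<lambda>j. cnj (y j)) \<theta>))\<^sup>2)) has_integral
      (B / 2 * (2 * pi * (\<Sum>k<n. (cmod (x k))\<^sup>2) + 2 * pi * (\<Sum>j<n. (cmod (cnj (y j)))\<^sup>2)))) {-pi..pi}"
    by (intro has_integral_mult_right has_integral_add Parseval_fourier_modes)
  then have J: "((\<lambda>\<theta>. B / 2 * ((cmod (?Q x \<theta>))\<^sup>2 + (cmod (?P \<theta>))\<^sup>2)) has_integral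
      (2 * pi * (B / 2 * ((\<Sum>k<n. (cmod (x k))\<^sup>2) + (\<Sum>j<n. (cmod (y j))\<^sup>2))))) {-pi..pi}"
    by (simp only: complex_mod_cnj) (simp add: algebra_simps)
  have "cmod (f \<theta> * ?P \<theta> * ?Q x \<theta>) \<le> B / 2 * ((cmod (?Q x \<theta>))\<^sup>2 + (cmod (?P \<theta>))\<^sup>2)" for \<theta>
  proof -
    have "cmod (?P \<theta>) * cmod (?Q x \<theta>) \<le> ((cmod (?Q x \<theta>))\<^sup>2 + (cmod (?P \<theta>))\<^sup>2) / 2"
      using sum_squares_bound[of "cmod (?P \<theta>)" "cmod (?Q x \<theta>)"] by simp
    with bound[of \<theta>] have "cmod (f \<theta>) * (cmod (?P \<theta>) * cmod (?Q x \<theta>))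
        \<le> B * (((cmod (?Q x \<theta>))\<^sup>2 + (cmod (?P \<theta>))\<^sup>2) / 2)"
      by (intro mult_mono) (auto intro: order_trans[OF norm_ge_zero])
    then show ?thesis by (simp only: norm_mult mult.assoc times_divide_eq_left times_divide_eq_right)
  qed
  then have "norm (integral {-pi..pi} (\<lambda>\<theta>. f \<theta> * ?P \<theta> * ?Q x \<theta>))
      \<le> integral {-pi..pi} (\<lambda>\<theta>. B / 2 * ((cmod (?Q x \<theta>))\<^sup>2 + (cmod (?P \<theta>))\<^sup>2))"
    using I J by (intro integral_norm_bound_integral) auto
  then have "2 * pi * cmod ?S \<le> 2 * pi * (B / 2 * ((\<Sum>k<n. (cmod (x k))\<^sup>2) + (\<Sum>j<n. (cmod (y j))\<^sup>2)))"
    unfolding integral_unique[OF I] integral_unique[OF J] by (simp add: norm_mult)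
  then show "cmod ?S \<le> B / 2 * ((\<Sum>k<n. (cmod (x k))\<^sup>2) + (\<Sum>j<n. (cmod (y j))\<^sup>2))"
    by (rule mult_left_le_imp_le) simp
qed

section \<open>Cyclic shifts and the norm bound for the optimal circulant\<close>

lemma bij_betw_add_mod: "bij_betw (\<lambda>j. (j + s) mod n) {..<n} {..<n::nat}"
proof (cases "n = 0")
  case False
  have "inj_on (\<lambda>j. (j + s) mod n) {..<n}"
  proof (rule inj_onI)
    fix i j assume ij: "i \<in> {..<n}" "j \<in> {..<n}" "(i + s) mod n = (j + s) mod n"
    then have "(int i + int s) mod int n = (int j + int s) mod int n"
      by (metis of_nat_add zmod_int)
    from mod_diff_cong[OF this refl, of "int s"] show "i = j" using ij by simp
  qed
  moreover have "(\<lambda>j. (j + s) mod n) ` {..<n} \<subseteq> {..<n}" using False by auto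
  ultimately show ?thesis
    by (simp add: bij_betw_def endo_inj_surj)
qed (simp add: bij_betw_def)

text \<open>The optimal circulant is the average of the conjugates of the Toeplitz matrix by the powers
  of the cyclic shift, so it inherits every bound that is invariant under permutations.\<close>

lemma opt_circ_coeff_average:
  assumes "j < n" "k < n"
  shows "opt_circ_coeff f n (nat ((int j - int k) mod int n))
    = (\<Sum>s<n. fourier_coeff f (int ((j + s) mod n) - int ((k + s) mod n))) / of_nat n"
proof -
  define d where "d = nat ((int j - int k) mod int n)"
  have n: "0 < n" using assms by simp
  have dn: "d < n" using n by (simp add: d_def nat_less_iff)
  \<comment> \<open>Cyclically, \<open>j\<close> stays \<open>d\<close> places ahead of
    \<open>k\<close> under every shift, so the summand depends only on the shifted position of
    \<open>k\<close>.\<close>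
  have shift: "(j + s) mod n = ((k + s) mod n + d) mod n" for s
  proof -
    have "int ((j + s) mod n) = (int k + int s + (int j - int k)) mod int n"
      by (simp add: zmod_int add.commute)
    also have "\<dots> = ((int k + int s) mod int n + (int j - int k) mod int n) mod int n"
      by (simp only: mod_add_eq)
    also have "\<dots> = int (((k + s) mod n + d) mod n)"
      using n by (simp add: zmod_int d_def)
    finally show ?thesis by simp
  qed
  let ?h = "\<lambda>t. fourier_coeff f (int ((t + d) mod n) - int t)"
  have "(\<Sum>s<n. fourier_coeff f (int ((j + s) mod n) - int ((k + s) mod n))) = (\<Sum>s<n. ?h ((s + k) mod n))"
    by (simp only: shift add.commute[of k])
  also have "\<dots> = (\<Sum>t<n. ?h t)"
    by (rule sum.reindex_bij_betw[OF bij_betw_add_mod])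
  \<comment> \<open>The first \<open>n - d\<close> positions do not wrap around and give the
    coefficient at \<open>d\<close>; the last \<open>d\<close> wrap once and give that at
    \<open>d - n\<close>. These counts are the weights in \<open>opt_circ_coeff\<close>.\<close>
  also have "\<dots> = (\<Sum>t<n - d. ?h t) + (\<Sum>t=n - d..<n. ?h t)"
    using sum.atLeastLessThan_concat[of 0 "n - d" n ?h] by (simp add: atLeast0LessThan)
  also have "(\<Sum>t<n - d. ?h t) = (\<Sum>t<n - d. fourier_coeff f (int d))"
    by (intro sum.cong) auto
  also have "(\<Sum>t=n - d..<n. ?h t) = (\<Sum>t=n - d..<n. fourier_coeff f (int d - int n))"
  proof (intro sum.cong refl)
    fix t assume t: "t \<in> {n - d..<n}"
    then have "(t + d) mod n = (t + d - n) mod n" using dn by (intro le_mod_geq) auto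
    also have "\<dots> = t + d - n" using t dn by (intro mod_less) auto
    finally have "(t + d) mod n = t + d - n" .
    then have "int ((t + d) mod n) - int t = int d - int n" using t dn by auto
    then show "?h t = fourier_coeff f (int d - int n)" by simp
  qed
  finally show ?thesis
    using dn unfolding opt_circ_coeff_def d_def[symmetric] by simp
qed

lemma form_le_opt_circulant:
  assumes f: "continuous_on UNIV f" and bound: "\<And>\<theta>. cmod (f \<theta>) \<le> B"
  shows "form_le n (\<lambda>j k. opt_circulant f n $$ (j,k)) B"
proof (cases "n = 0")
  case False
  have "form_le n (\<lambda>j k. (\<Sum>s<n. fourier_coeff f (int ((j + s) mod n) - int ((k + s) mod n))) / of_nat n) B"
    using False
    by (intro form_le_average form_le_permute[OF form_le_toeplitz[OF assms] bij_betw_add_mod]) auto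
  then show ?thesis
    unfolding form_le_def by (simp add: opt_circulant_def opt_circ_coeff_average)
qed (simp add: form_le_def)

lemma toeplitz_mat_carrier [simp]: "toeplitz_mat f n \<in> carrier_mat n n"
  by (simp add: toeplitz_mat_def)

lemma opt_circulant_carrier [simp]: "opt_circulant f n \<in> carrier_mat n n"
  by (simp add: opt_circulant_def)

lemma opnorm_le_toeplitz:
  assumes "continuous_on UNIV f" "\<And>\<theta>. cmod (f \<theta>) \<le> B" "0 < B"
  shows "opnorm_le (toeplitz_mat f n) B"
  using form_le_toeplitz[OF assms(1,2), of n] assms(3)
  by (intro opnorm_le_if_form_le[of _ n]) (simp_all add: toeplitz_mat_def form_le_def)

lemma opnorm_le_opt_circulant:
  assumes "continuous_on UNIV f" "\<And>\<theta>. cmod (f \<theta>) \<le> B" "0 < B"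
  shows "opnorm_le (opt_circulant f n) B"
  using form_le_opt_circulant[OF assms(1,2)] assms(3)
  by (intro opnorm_le_if_form_le[of _ n]) simp_all

section \<open>Trigonometric approximation\<close>

inductive trig_poly :: "(real \<Rightarrow> complex) \<Rightarrow> bool" where
  mode: "trig_poly (\<lambda>\<theta>. c * fourier_mode k \<theta>)"
| add: "trig_poly p \<Longrightarrow> trig_poly q \<Longrightarrow> trig_poly (\<lambda>\<theta>. p \<theta> + q \<theta>)"

lemma continuous_on_trig_poly: "trig_poly p \<Longrightarrow> continuous_on S p"
  by (induction rule: trig_poly.induct) (auto intro!: continuous_intros)

lemma trig_poly_const: "trig_poly (\<lambda>\<theta>. c)"
  using trig_poly.mode[of c 0] by (simp add: fourier_mode_def)

lemma trig_poly_mult_mode: "trig_poly p \<Longrightarrow> trig_poly (\<lambda>\<theta>. c * fourier_mode k \<theta> * p \<theta>)"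
proof (induction rule: trig_poly.induct)
  case (mode d m)
  have "c * fourier_mode k \<theta> * (d * fourier_mode m \<theta>) = (c * d) * fourier_mode (k + m) \<theta>" for \<theta>
    by (simp add: mult_ac flip: fourier_mode_mult)
  then show ?case using trig_poly.mode[of "c * d" "k + m"] by (simp only:)
next
  case (add p q)
  then show ?case using trig_poly.add by (simp add: distrib_left)
qed

lemma trig_poly_mult: "trig_poly p \<Longrightarrow> trig_poly q \<Longrightarrow> trig_poly (\<lambda>\<theta>. p \<theta> * q \<theta>)"
proof (induction rule: trig_poly.induct)
  case (add p p')
  then show ?case using trig_poly.add by (simp add: distrib_right)
qed (rule trig_poly_mult_mode)

lemma trig_poly_cos: "trig_poly (\<lambda>\<theta>. of_real (cos \<theta>))"
proof -
  have "complex_of_real (cos \<theta>) = 1/2 * fourier_mode 1 \<theta> + 1/2 * fourier_mode (-1) \<theta>" for \<theta>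
    by (simp add: fourier_mode_def cos_of_real[symmetric] cos_exp_eq)
  then show ?thesis using trig_poly.add[OF trig_poly.mode[of "1/2" 1] trig_poly.mode[of "1/2" "-1"]] by simp
qed

lemma trig_poly_sin: "trig_poly (\<lambda>\<theta>. of_real (sin \<theta>))"
proof -
  have "complex_of_real (sin \<theta>) = (- \<i>/2) * fourier_mode 1 \<theta> + (\<i>/2) * fourier_mode (-1) \<theta>" for \<theta>
    by (simp add: fourier_mode_def sin_of_real[symmetric] sin_exp_eq field_simps)
  then show ?thesis using trig_poly.add[OF trig_poly.mode[of "-\<i>/2" 1] trig_poly.mode[of "\<i>/2" "-1"]] by simp
qed

text \<open>On the unit circle a real linear functional is a combination of cosine and sine;
  constants, sums and products stay within trigonometric polynomials. This transfers polynomial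
  approximation on the circle to the modes.\<close>

lemma trig_poly_real_polynomial_cis:
  fixes h :: "complex \<Rightarrow> real"
  assumes "real_polynomial_function h"
  shows "trig_poly (\<lambda>\<theta>. of_real (h (cis \<theta>)))"
  using assms
proof (induction rule: real_polynomial_function.induct)
  case (linear h)
  interpret bounded_linear h by fact
  have "h (cis \<theta>) = h 1 * cos \<theta> + h \<i> * sin \<theta>" for \<theta>
  proof -
    have "cis \<theta> = cos \<theta> *\<^sub>R 1 + sin \<theta> *\<^sub>R \<i>"
      by (simp add: complex_eq_iff)
    then show ?thesis by (simp only: add scaleR) simp
  qed
  then show ?case
    using trig_poly.add[OF trig_poly_mult[OF trig_poly_const trig_poly_cos] trig_poly_mult[OF trig_poly_const trig_poly_sin]]
    by simp
qed (simp_all add: trig_poly_const trig_poly.add trig_poly_mult)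

lemma trig_poly_polynomial_cis:
  fixes g :: "complex \<Rightarrow> complex"
  assumes "polynomial_function g"
  shows "trig_poly (\<lambda>\<theta>. g (cis \<theta>))"
proof -
  have "real_polynomial_function (Re \<circ> g)" "real_polynomial_function (Im \<circ> g)"
    using assms by (simp_all add: polynomial_function_def bounded_linear_Re bounded_linear_Im)
  from this[THEN trig_poly_real_polynomial_cis]
  have "trig_poly (\<lambda>\<theta>. of_real (Re (g (cis \<theta>))) + \<i> * of_real (Im (g (cis \<theta>))))"
    by (intro trig_poly.add trig_poly_mult trig_poly_const) simp_all
  then show ?thesis by (simp flip: complex_eq)
qed

text \<open>A homotopy statement about loops is used only for the continuity on the circle of the
  function induced by \<open>f\<close>, of which the branch cut of the argument is the delicate point.\<close>

lemma trig_poly_approx: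
  assumes cont: "continuous_on UNIV f" and periodic: "\<And>x. f (x + 2 * pi) = f x" and e: "0 < e"
  obtains p where "trig_poly p" "\<And>\<theta>. cmod (f \<theta> - p \<theta>) < e"
proof -
  let ?p = "\<lambda>t. f (2 * pi * t)"
  have per: "f (x + 2 * pi * of_int k) = f x" for x k
  proof (induction k rule: int_induct[where k = 0])
    case (step1 i)
    then show ?case using periodic[of "x + 2 * pi * of_int i"] by (simp add: algebra_simps)
  next
    case (step2 i)
    then show ?case using periodic[of "x + 2 * pi * of_int (i - 1)"] by (simp add: algebra_simps)
  qed simp
  have "path ?p"
    unfolding path_def by (intro continuous_on_compose2[OF cont] continuous_intros) auto
  then have "homotopic_loops UNIV ?p ?p"
    using periodic[of 0] by (simp add: homotopic_loops_refl pathfinish_def pathstart_def)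
  \<comment> \<open>The constant homotopy from the loop to itself suffices: the circle map induced
    by an endpoint of a homotopy is continuous.\<close>
  from homotopic_with_imp_continuous[OF homotopic_loops_imp_homotopic_circlemaps[OF this]]
  have "continuous_on (sphere 0 1) (?p \<circ> (\<lambda>z. Arg2pi z / (2 * pi)))"
    by blast
  then have "continuous_on (sphere 0 1) (\<lambda>z. f (Arg2pi z))"
    by (simp add: o_def)
  from Stone_Weierstrass_polynomial_function[OF compact_sphere this e]
  obtain g where g: "polynomial_function g" "\<And>z. z \<in> sphere 0 1 \<Longrightarrow> norm (f (Arg2pi z) - g z) < e"
    by blast
  \<comment> \<open>The argument recovers \<open>\<theta>\<close> only up to a multiple of
    \<open>2 * pi\<close>, which periodicity absorbs.\<close>
  have "f (Arg2pi (cis \<theta>)) = f \<theta>" for \<theta>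
  proof -
    have "exp (\<i> * of_real (Arg2pi (cis \<theta>))) = exp (\<i> * of_real \<theta>)"
      using complex_norm_eq_1_exp[of "cis \<theta>"] by (simp add: cis_conv_exp)
    then obtain k where "\<i> * of_real (Arg2pi (cis \<theta>)) = \<i> * of_real \<theta> + of_int (2 * k) * pi * \<i>"
      unfolding exp_eq by auto
    then have "Arg2pi (cis \<theta>) = \<theta> + 2 * pi * of_int k"
      by (simp add: complex_eq_iff)
    then show ?thesis by (simp add: per)
  qed
  then have "cmod (f \<theta> - g (cis \<theta>)) < e" for \<theta>
    using g(2)[of "cis \<theta>"] by simp
  with that[OF trig_poly_polynomial_cis[OF g(1)]] show ?thesis by blast
qed

section \<open>The difference of the circulant and the Toeplitz matrix\<close>

definition circ_defect :: "(real \<Rightarrow> complex) \<Rightarrow> nat \<Rightarrow> complex mat" where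
  "circ_defect f n = opt_circulant f n - toeplitz_mat f n"

lemma circ_defect_carrier [simp]: "circ_defect f n \<in> carrier_mat n n"
  unfolding circ_defect_def by (intro minus_carrier_mat) simp

lemma circ_defect_index:
  assumes "i < n" "j < n"
  shows "circ_defect f n $$ (i,j) =
    opt_circ_coeff f n (nat ((int i - int j) mod int n)) - fourier_coeff f (int i - int j)"
  using assms by (simp add: circ_defect_def opt_circulant_def toeplitz_mat_def)

lemma circ_defect_add:
  assumes "continuous_on UNIV f" "continuous_on UNIV g"
  shows "circ_defect (\<lambda>\<theta>. f \<theta> + g \<theta>) n = circ_defect f n + circ_defect g n"
proof (rule eq_matI)
  show "circ_defect (\<lambda>\<theta>. f \<theta> + g \<theta>) n $$ (i,j) = (circ_defect f n + circ_defect g n) $$ (i,j)"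
    if "i < dim_row (circ_defect f n + circ_defect g n)" "j < dim_col (circ_defect f n + circ_defect g n)" for i j
    using that carrier_matD[OF circ_defect_carrier, of g n]
    by (simp add: circ_defect_index opt_circ_coeff_def fourier_coeff_add[OF assms] add_divide_distrib algebra_simps)
qed (use carrier_matD[OF circ_defect_carrier] in simp_all)

lemma circ_defect_diff:
  assumes "continuous_on UNIV f" "continuous_on UNIV g"
  shows "circ_defect (\<lambda>\<theta>. f \<theta> - g \<theta>) n = circ_defect f n - circ_defect g n"
proof (rule eq_matI)
  show "circ_defect (\<lambda>\<theta>. f \<theta> - g \<theta>) n $$ (i,j) = (circ_defect f n - circ_defect g n) $$ (i,j)"
    if "i < dim_row (circ_defect f n - circ_defect g n)" "j < dim_col (circ_defect f n - circ_defect g n)" for i j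
    using that carrier_matD[OF circ_defect_carrier, of g n]
    by (simp add: circ_defect_index opt_circ_coeff_def fourier_coeff_diff[OF assms] add_divide_distrib diff_divide_distrib algebra_simps)
qed (use carrier_matD[OF circ_defect_carrier] in simp_all)

lemma opnorm_le_circ_defect:
  assumes "continuous_on UNIV f" "\<And>\<theta>. cmod (f \<theta>) \<le> B" "0 < B"
  shows "opnorm_le (circ_defect f n) (2 * B)"
  using opnorm_le_diff[OF opt_circulant_carrier toeplitz_mat_carrier
      opnorm_le_opt_circulant[OF assms] opnorm_le_toeplitz[OF assms]]
  by (simp add: circ_defect_def)

text \<open>Away from the first and the last \<open>\<bar>k\<bar>\<close> rows, the wrapped-around diagonals of the
  circulant are not met, and only the factor \<open>(n - \<bar>k\<bar>) / n\<close> on the diagonal \<open>i - j = k\<close> remains.\<close>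

lemma circ_defect_mode_index:
  assumes ij: "i < n" "j < n" and k: "nat \<bar>k\<bar> \<le> i" "i < n - nat \<bar>k\<bar>"
  shows "circ_defect (\<lambda>\<theta>. c * fourier_mode k \<theta>) n $$ (i,j)
    = (if int i - int j = k then - c * of_nat (nat \<bar>k\<bar>) / of_nat n else 0)"
proof -
  have n: "0 < n" using ij by simp
  consider (ge) "j \<le> i" | (less) "i < j" by linarith
  then show ?thesis
  proof cases
    case ge
    then have m: "nat ((int i - int j) mod int n) = i - j"
      using ij by (simp add: nat_diff_distrib)
    \<comment> \<open>The other coefficient, at \<open>i - j - n\<close>, could equal the one at
      \<open>k\<close> only if \<open>i = j + n - |k|\<close>, which the upper bound on
      \<open>i\<close> excludes.\<close>
    have "opt_circ_coeff (\<lambda>\<theta>. c * fourier_mode k \<theta>) n (i - j)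
        = (if int i - int j = k then of_nat (n - nat \<bar>k\<bar>) * c / of_nat n else 0)"
      using ij k ge by (auto simp: opt_circ_coeff_def fourier_coeff_mode)
    then show ?thesis
      using ij k n by (auto simp: circ_defect_index m fourier_coeff_mode of_nat_diff field_simps)
  next
    case less
    have "(int i - int j) mod int n = int i - int j + int n"
    proof -
      have "(int i - int j) mod int n = (int i - int j + int n) mod int n" by simp
      also have "\<dots> = int i - int j + int n"
        using ij less by (intro mod_pos_pos_trivial) auto
      finally show ?thesis .
    qed
    then have m: "nat ((int i - int j) mod int n) = n - (j - i)"
      using ij less by simp
    \<comment> \<open>Here the wrapped coefficient sits at \<open>i - j + n\<close>; if this were
      \<open>k\<close>, then \<open>i = k - (n - j)\<close> would lie below \<open>|k|\<close>,
      against the lower bound on \<open>i\<close>.\<close>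
    have "opt_circ_coeff (\<lambda>\<theta>. c * fourier_mode k \<theta>) n (n - (j - i))
        = (if int i - int j = k then of_nat (n - nat \<bar>k\<bar>) * c / of_nat n else 0)"
      using ij k less by (auto simp: opt_circ_coeff_def fourier_coeff_mode of_nat_diff)
    then show ?thesis
      using ij k n by (auto simp: circ_defect_index m fourier_coeff_mode of_nat_diff field_simps)
  qed
qed

lemma opnorm_le_diagonal:
  assumes A: "A \<in> carrier_mat n n" and B: "0 < B"
    and diag: "\<And>i j. i < n \<Longrightarrow> j < n \<Longrightarrow> cmod (A $$ (i,j)) \<le> (if int i - int j = k then B else 0)"
  shows "opnorm_le A B"
proof (rule opnorm_le_if_form_le[OF A form_le_Schur B])
  show "(\<Sum>j<n. cmod (A $$ (i,j))) \<le> B" if i: "i < n" for i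
  proof -
    \<comment> \<open>A row meets the diagonal at most once. Should \<open>int i - k\<close> be
      negative, \<open>nat\<close> returns 0 and the right side is merely larger.\<close>
    have "(\<Sum>j<n. cmod (A $$ (i,j))) \<le> (\<Sum>j<n. if nat (int i - k) = j then B else 0)"
      using i B by (intro sum_mono order_trans[OF diag]) auto
    also have "\<dots> \<le> B" using B by simp
    finally show ?thesis .
  qed
  show "(\<Sum>i<n. cmod (A $$ (i,j))) \<le> B" if j: "j < n" for j
  proof -
    have "(\<Sum>i<n. cmod (A $$ (i,j))) \<le> (\<Sum>i<n. if nat (int j + k) = i then B else 0)"
      using j B by (intro sum_mono order_trans[OF diag]) auto
    also have "\<dots> \<le> B" using B by simp
    finally show ?thesis .
  qed
qed

lemma acs_null_circ_defect_mode: "acs_null (circ_defect (\<lambda>\<theta>. c * fourier_mode k \<theta>))"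
  unfolding acs_null_def
proof (intro allI impI)
  fix \<epsilon> :: real assume \<epsilon>: "0 < \<epsilon>"
  define K where "K = nat \<bar>k\<bar>"
  \<comment> \<open>Beyond this \<open>N\<close> the remaining diagonal, of modulus
    \<open>cmod c * K / n\<close>, is below \<open>\<epsilon>\<close>.\<close>
  obtain N :: nat where N: "cmod c * real K / \<epsilon> < real N"
    using reals_Archimedean2 by blast
  let ?V = "circ_defect (\<lambda>\<theta>. c * fourier_mode k \<theta>)"
  show "\<exists>N M. \<forall>n>N. \<exists>R E. R \<in> carrier_mat n n \<and> E \<in> carrier_mat n n \<and>
     ?V n = R + E \<and> rank_le n R M \<and> opnorm_le E \<epsilon>"
  proof (rule exI[of _ N], rule exI[of _ "2 * K"], intro allI impI)
    fix n assume n: "N < n"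
    \<comment> \<open>The first and last \<open>K\<close> rows contain the wrapped diagonals. For
      small \<open>n\<close> the two blocks may overlap, but their union still has at most
      \<open>2 * K\<close> elements.\<close>
    define S where "S = {..<K} \<union> {n - K..<n}"
    let ?R = "mat n n (\<lambda>(i,j). if i \<in> S then ?V n $$ (i,j) else 0)"
    let ?E = "mat n n (\<lambda>(i,j). if i \<in> S then 0 else ?V n $$ (i,j))"
    have "card S \<le> card {..<K} + card {n - K..<n}"
      unfolding S_def by (rule card_Un_le)
    then have "rank_le n ?R (2 * K)"
      by (intro rank_le_rows[where S = S]) (auto simp: S_def)
    moreover have "opnorm_le ?E \<epsilon>"
    proof (rule opnorm_le_diagonal[OF _ \<epsilon>, of _ n k])
      fix i j assume ij: "i < n" "j < n"
      show "cmod (?E $$ (i,j)) \<le> (if int i - int j = k then \<epsilon> else 0)"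
      proof (cases "i \<in> S")
        case False
        have "cmod c * real K / real n \<le> \<epsilon>"
          using N n \<epsilon> by (simp add: divide_simps split: if_splits) (smt (verit) mult_left_mono mult.commute of_nat_less_iff)
        moreover have "?V n $$ (i,j) = (if int i - int j = k then - c * of_nat K / of_nat n else 0)"
          unfolding K_def using False ij by (intro circ_defect_mode_index) (auto simp: S_def K_def)
        ultimately show ?thesis using False ij by (simp add: norm_divide norm_mult)
      qed (use ij \<epsilon> in simp)
    qed simp
    moreover have "?V n = ?R + ?E"
      using carrier_matD[OF circ_defect_carrier] by (intro eq_matI) auto
    ultimately show "\<exists>R E. R \<in> carrier_mat n n \<and> E \<in> carrier_mat n n \<and>
       ?V n = R + E \<and> rank_le n R (2 * K) \<and> opnorm_le E \<epsilon>"
      by (intro exI[of _ ?R] exI[of _ ?E]) auto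
  qed
qed

lemma acs_null_circ_defect_trig_poly: "trig_poly p \<Longrightarrow> acs_null (circ_defect p)"
proof (induction rule: trig_poly.induct)
  case (add p q)
  then have "circ_defect (\<lambda>\<theta>. p \<theta> + q \<theta>) = (\<lambda>n. circ_defect p n + circ_defect q n)"
    by (simp add: fun_eq_iff circ_defect_add continuous_on_trig_poly)
  then show ?case using acs_null_add[OF add.IH] by simp
qed (rule acs_null_circ_defect_mode)

lemma acs_null_circ_defect:
  assumes cont: "continuous_on UNIV f" and periodic: "\<And>x. f (x + 2 * pi) = f x"
  shows "acs_null (circ_defect f)"
proof (rule acs_null_limit)
  fix \<delta> :: real assume \<delta>: "0 < \<delta>"
  then obtain p where p: "trig_poly p" "\<And>\<theta>. cmod (f \<theta> - p \<theta>) < \<delta> / 2"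
    \<comment> \<open>Circulant and Toeplitz matrix each contribute the supremum of
      \<open>f - p\<close> to the norm, hence the accuracy \<open>\<delta> / 2\<close>.\<close>
    using trig_poly_approx[OF cont periodic, of "\<delta> / 2"] by auto
  have "opnorm_le (circ_defect (\<lambda>\<theta>. f \<theta> - p \<theta>) n) (2 * (\<delta> / 2))" for n
    using p \<delta>
    by (intro opnorm_le_circ_defect continuous_on_diff cont continuous_on_trig_poly) (auto intro: less_imp_le)
  then have "opnorm_le (circ_defect f n - circ_defect p n) \<delta>" for n
    using circ_defect_diff[OF cont continuous_on_trig_poly[OF p(1)]] by simp
  then show "\<exists>W. acs_null W \<and> (\<forall>n. W n \<in> carrier_mat n n \<and> opnorm_le (circ_defect f n - W n) \<delta>)"
    using acs_null_circ_defect_trig_poly[OF p(1)] by (intro exI[of _ "circ_defect p"]) simp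
qed simp

text \<open>A trigonometric polynomial is bounded since modes have modulus one, and \<open>f\<close>
  stays within distance 1 of such a polynomial.\<close>

lemma periodic_continuous_bounded:
  assumes "continuous_on UNIV f" "\<And>x. f (x + 2 * pi) = f x"
  obtains B where "0 < B" "\<And>\<theta>. cmod (f \<theta>) \<le> B"
proof -
  obtain p where p: "trig_poly p" "\<And>\<theta>. cmod (f \<theta> - p \<theta>) < 1"
    using trig_poly_approx[OF assms, of 1] by auto
  have "\<exists>C. \<forall>\<theta>. cmod (p \<theta>) \<le> C"
    using p(1)
  proof (induction rule: trig_poly.induct)
    case (mode c k)
    have "cmod (fourier_mode k \<theta>) = 1" for \<theta>
      unfolding fourier_mode_def by (simp add: norm_exp_eq_Re)
    then show ?case by (auto simp: norm_mult)
  next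
    case (add p q)
    then show ?case by (meson add_mono norm_triangle_ineq order_trans)
  qed
  then obtain C where C: "\<And>\<theta>. cmod (p \<theta>) \<le> C" by blast
  have "cmod (f \<theta>) \<le> C + 1" for \<theta>
    using p(2)[of \<theta>] C[of \<theta>] norm_triangle_ineq2[of "f \<theta>" "p \<theta>"] by linarith
  moreover have "0 < C + 1" using C[of 0] norm_ge_zero[of "p 0"] by linarith
  ultimately show ?thesis using that by blast
qed

theorem mainTheorem5:
  fixes f :: "real \<Rightarrow> complex"
  assumes cont: "continuous_on UNIV f"
    and periodic: "\<forall>x. f (x + 2 * pi) = f x"
  shows "\<forall>\<epsilon>>0. \<exists>N M :: nat. 0 < N \<and> 0 < M \<and>
           (\<forall>n>N. \<exists>R E :: complex mat.
              R \<in> carrier_mat n n \<and> E \<in> carrier_mat n n \<and>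
              mat_sin (opt_circulant f n) - mat_sin (toeplitz_mat f n) = R + E \<and>
              vec_space.rank n R \<le> 2 * M \<and> spec_norm E \<le> \<epsilon>)"
proof (intro allI impI)
  fix \<epsilon> :: real assume \<epsilon>: "0 < \<epsilon>"
  have per: "\<And>x. f (x + 2 * pi) = f x" using periodic by blast
  obtain B where B: "0 < B" "\<And>\<theta>. cmod (f \<theta>) \<le> B"
    using periodic_continuous_bounded[OF cont per] by blast
  have "acs_null (\<lambda>n. opt_circulant f n - toeplitz_mat f n)"
    using acs_null_circ_defect[OF cont per] by (simp add: circ_defect_def[abs_def])
  then have "acs_null (\<lambda>n. mat_sin (opt_circulant f n) - mat_sin (toeplitz_mat f n))"
    using B by (intro acs_null_mat_sin_diff[where B = B] opnorm_le_opt_circulant opnorm_le_toeplitz cont) auto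
  then obtain N M where NM: "\<And>n. n > N \<Longrightarrow> \<exists>R E. R \<in> carrier_mat n n \<and> E \<in> carrier_mat n n \<and>
      mat_sin (opt_circulant f n) - mat_sin (toeplitz_mat f n) = R + E \<and> rank_le n R M \<and> opnorm_le E \<epsilon>"
    using acs_nullE[OF _ \<epsilon>] by blast
  show "\<exists>N M :: nat. 0 < N \<and> 0 < M \<and>
           (\<forall>n>N. \<exists>R E :: complex mat.
              R \<in> carrier_mat n n \<and> E \<in> carrier_mat n n \<and>
              mat_sin (opt_circulant f n) - mat_sin (toeplitz_mat f n) = R + E \<and>
              vec_space.rank n R \<le> 2 * M \<and> spec_norm E \<le> \<epsilon>)"
  \<comment> \<open>Successors make both numbers positive; the rank bound \<open>M\<close> lies well
    below \<open>2 * Suc M\<close>.\<close>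
  proof (rule exI[of _ "Suc N"], rule exI[of _ "Suc M"], intro conjI allI impI)
    fix n assume "Suc N < n"
    then obtain R E where RE: "R \<in> carrier_mat n n" "E \<in> carrier_mat n n"
      "mat_sin (opt_circulant f n) - mat_sin (toeplitz_mat f n) = R + E" "rank_le n R M" "opnorm_le E \<epsilon>"
      using NM[of n] by auto
    have "vec_space.rank n R \<le> 2 * Suc M" using vec_space_rank_le[OF RE(4)] by simp
    moreover have "spec_norm E \<le> \<epsilon>" using spec_norm_le[OF RE(5)] \<epsilon> by simp
    ultimately show "\<exists>R E :: complex mat. R \<in> carrier_mat n n \<and> E \<in> carrier_mat n n \<and>
        mat_sin (opt_circulant f n) - mat_sin (toeplitz_mat f n) = R + E \<and>
        vec_space.rank n R \<le> 2 * Suc M \<and> spec_norm E \<le> \<epsilon>"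
      using RE by blast
  qed simp_all
qed

end
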